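(* Let $(U_t,V_t)_{t\in\mathbb{Z}^+}$ be a Markov chain on the strip $\mathcal{A}\times\mathbb{Z}$, where $\mathcal{A} = \{0,1,\ldots,k-1\}$ for some $k \in \mathbb{N}$ or $\mathcal{A}=\mathbb{Z}^+$, with transition probabilities $$\mathbb{P} [ (U_{t+1}, V_{t+1} ) = (\ell', x + d) \mid U_t =\ell, V_t =x ] = \phi ( \ell, \ell'; d)$$ not depending on $x$, and suppose that the induced Markov chain $(U_t)$ on $\mathcal{A}$ is irreducible and null-recurrent, and that, for some $\gamma \in (0,1]$, $$\lim_{t\to \infty} \frac{\log \mathbb{P} [ \nu > t]}{\log t} = - \gamma .$$ Suppose that there exist $\alpha \in (0,1)$, $\beta > 0$, and $C < \infty$ such that (i) $M_\ell^- (\beta) \leq C$ for all $\ell \in \mathcal{A}$; (ii) $$\lim_{x \to \infty} \frac{ \log T_0^+ (x)}{\log x} = -\alpha;$$ and (iii) $M_\ell^+(\beta) \leq C$ for all $\ell\in\mathcal{A}$ with $\ell \neq 0$. Then if $\alpha < \gamma \min(\beta, 1)$, $V_t \to +\infty$ a.s. as $t \to \infty$, and, moreover, $$\lim_{t \to \infty} \frac{ \log V_t}{\log t} = \frac{\gamma}{\alpha} \quad \text{a.s.}$$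
   Context: $\mathbb{Z}^+ = \{0,1,2,\ldots\}$, $\mathbb{N}=\{1,2,\ldots\}$. For real $x$, $x^+ := x \mathbf{1}\{x>0\}$ and $x^- := -x\mathbf{1}\{x<0\}$. Because the transition probabilities depend only on $\ell,\ell',d$, the projection $(U_t)$ is itself a Markov chain on $\mathcal{A}$, with transition probabilities $q_{\ell,\ell'} = \sum_{d\in\mathbb{Z}}\phi(\ell,\ell';d)$ (the induced chain). $\nu := \min \{ t \in \mathbb{N} : U_t = 0 \}$ is the time of first return to the $0$-line, and its law $\mathbb{P}[\nu > t]$ is taken with $U_0=0$. For $x \geq 0$, $\ell\in\mathcal{A}$ and $\beta>0$, $$T_\ell^\pm (x) := \mathbb{P} [ (V_{t+1} - V_t)^\pm > x \mid U_t = \ell, V_t = z ], \qquad M_\ell ^\pm (\beta ) := \mathbb{E} [ ( (V_{t+1} - V_t)^\pm )^\beta \mid U_t = \ell, V_t = z ],$$ which do not depend on $z$ or $t$. *)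

theory Defs
  imports "HOL-Probability.Probability"
begin

section \<open>Countable-state Markov chains\<close>

text \<open>Homogeneous Markov chain with an arbitrary initial distribution. The Markov property is
  required relative to the full history, for histories of positive probability.\<close>

definition markov_chain ::
  "'w measure \<Rightarrow> 's::countable set \<Rightarrow> ('s \<Rightarrow> 's pmf) \<Rightarrow> (nat \<Rightarrow> 'w \<Rightarrow> 's) \<Rightarrow> bool" where
  "markov_chain M S K X \<longleftrightarrow>
     prob_space M \<and>
     (\<forall>t. X t \<in> M \<rightarrow>\<^sub>M count_space UNIV) \<and>
     (\<forall>t. \<forall>\<omega>\<in>space M. X t \<omega> \<in> S) \<and>
     (\<forall>t x y. \<P>(\<omega> in M. \<forall>s\<le>t. X s \<omega> = x s) > 0 \<longrightarrow>
        \<P>(\<omega> in M. X (Suc t) \<omega> = y \<bar> \<forall>s\<le>t. X s \<omega> = x s) = pmf (K (x t)) y)"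

text \<open>The law on path space of the chain with kernel \<open>K\<close> started from the state \<open>x\<close>, obtained
  from the Ionescu-Tulcea theorem.\<close>

definition step_law :: "('s \<Rightarrow> 's pmf) \<Rightarrow> 's \<Rightarrow> nat \<Rightarrow> (nat \<Rightarrow> 's) \<Rightarrow> 's measure" where
  "step_law K x n \<omega> =
     (case n of 0 \<Rightarrow> return (count_space UNIV) x | Suc i \<Rightarrow> measure_pmf (K (\<omega> i)))"

definition chain_law :: "('s \<Rightarrow> 's pmf) \<Rightarrow> 's \<Rightarrow> (nat \<Rightarrow> 's) measure" where
  "chain_law K x =
     projective_family.lim UNIV
       (Ionescu_Tulcea.CI (step_law K x) (\<lambda>_. count_space UNIV)) (\<lambda>_. count_space UNIV)"

lemma step_law_measurable:
  "step_law K x n \<in> PiM {0..<n} (\<lambda>_. count_space UNIV) \<rightarrow>\<^sub>M subprob_algebra (count_space UNIV)"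
proof (cases n)
  case 0
  then show ?thesis
    by (simp add: step_law_def[abs_def] space_subprob_algebra
        prob_space_return prob_space_imp_subprob_space)
next
  case (Suc i)
  have 1: "(\<lambda>\<omega>. \<omega> i) \<in> PiM {0..<n} (\<lambda>_. count_space UNIV) \<rightarrow>\<^sub>M count_space UNIV"
    by (rule measurable_component_singleton) (simp add: Suc)
  have 2: "(\<lambda>y. measure_pmf (K y)) \<in> count_space UNIV \<rightarrow>\<^sub>M subprob_algebra (count_space UNIV)"
    by (simp add: space_subprob_algebra measure_pmf.subprob_space_axioms)
  show ?thesis
    using measurable_compose[OF 1 2] by (simp add: step_law_def[abs_def] Suc)
qed

lemma Ionescu_Tulcea_step_law:
  fixes x :: 'a
  shows "Ionescu_Tulcea (step_law K x) (\<lambda>_. count_space UNIV)"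
proof (rule Ionescu_Tulcea.intro)
  show "step_law K x i \<in> PiM {0..<i} (\<lambda>_. count_space UNIV) \<rightarrow>\<^sub>M subprob_algebra (count_space UNIV)"
    for i by (rule step_law_measurable)
  show "prob_space (step_law K x i \<omega>)" for i and \<omega> :: "nat \<Rightarrow> 'a"
    by (cases i) (auto simp: step_law_def prob_space_return measure_pmf.prob_space_axioms)
qed

lemma sets_chain_law:
  "sets (chain_law K x) = sets (PiM UNIV (\<lambda>_. count_space UNIV))"
proof -
  interpret IT: Ionescu_Tulcea "step_law K x" "\<lambda>_. count_space UNIV"
    by (rule Ionescu_Tulcea_step_law)
  show ?thesis unfolding chain_law_def by (rule IT.PF.sets_lim)
qed

lemma space_chain_law [simp]: "space (chain_law K x) = UNIV"
  using sets_eq_imp_space_eq[OF sets_chain_law] by (simp add: space_PiM)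

lemma coordinate_measurable_chain_law:
  "(\<lambda>\<omega>. \<omega> t) \<in> chain_law K x \<rightarrow>\<^sub>M count_space UNIV"
  unfolding measurable_cong_sets[OF sets_chain_law refl]
  by (rule measurable_component_singleton) simp

lemma prob_space_chain_law: "prob_space (chain_law K x)"
proof -
  interpret IT: Ionescu_Tulcea "step_law K x" "\<lambda>_. count_space UNIV"
    by (rule Ionescu_Tulcea_step_law)
  let ?S = "space (PiM {} (\<lambda>_. count_space UNIV)) :: (nat \<Rightarrow> 'a) set"
  have "emeasure IT.PF.lim (IT.PF.emb UNIV {} ?S) = emeasure (IT.CI {}) ?S"
    by (rule IT.lim) auto
  also have "\<dots> = 1"
    using prob_space.emeasure_space_1[OF IT.PF.prob_space_P[of "{}"]]
    by (simp add: IT.CI_def)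
  also have "IT.PF.emb UNIV {} ?S = space IT.PF.lim"
    by (auto simp: prod_emb_def space_PiM)
  finally show ?thesis
    unfolding chain_law_def by (intro prob_spaceI) simp
qed

lemma cylinder_chain_law:
  fixes K :: "'s::countable \<Rightarrow> 's pmf"
  shows "\<P>(\<omega> in chain_law K x0. \<forall>s\<le>n. \<omega> s = x s) =
    (if x 0 = x0 then \<Prod>s<n. pmf (K (x s)) (x (Suc s)) else 0)"
proof -
  interpret IT: Ionescu_Tulcea "step_law K x0" "\<lambda>_. count_space UNIV"
    by (rule Ionescu_Tulcea_step_law)
  let ?M = "\<lambda>n. PiM {0..<n} (\<lambda>_. count_space (UNIV :: 's set))"
  let ?p = "\<lambda>n. if x 0 = x0 then \<Prod>s<n. pmf (K (x s)) (x (Suc s)) else 0"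
  let ?u = "\<lambda>_::nat. undefined :: 's"
  define Cy where "Cy n = {restrict x {0..<n}}" for n
  have Cy_space: "restrict x {0..<n} \<in> space (?M n)" for n
    by (auto simp: space_PiM)
  have Cy_eq: "Cy n = PiE {0..<n} (\<lambda>i. {x i})" for n
    by (auto simp: Cy_def PiE_iff extensional_def fun_eq_iff)
  have Cy_sets [measurable]: "Cy n \<in> sets (?M n)" for n
    unfolding Cy_eq by (rule sets_PiM_I_finite) auto
  have und: "?u \<in> space (?M 0)" by (simp add: space_PiM)
  have stp: "emeasure (IT.eP n \<omega>) (Cy (Suc n)) =
      emeasure (step_law K x0 n (restrict x {0..<n})) {x n} * indicator (Cy n) \<omega>"
    if w: "\<omega> \<in> space (?M n)" for n \<omega>
  proof -
    have "fun_upd \<omega> n -` Cy (Suc n) = (if \<omega> \<in> Cy n then {x n} else {})"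
    proof -
      have "\<omega> i = undefined" if "i \<ge> n" for i
        using w that by (auto simp: space_PiM PiE_iff extensional_def)
      then have "fun_upd \<omega> n y = restrict x {0..<Suc n} \<longleftrightarrow> y = x n \<and> \<omega> = restrict x {0..<n}" for y
        by (auto simp: fun_eq_iff restrict_def less_Suc_eq)
      then show ?thesis by (auto simp: Cy_def)
    qed
    then show ?thesis
      using IT.emeasure_eP[OF w Cy_sets[of "Suc n"]] by (auto simp: Cy_def)
  qed
  have base: "emeasure (IT.C 0 n ?u) (Cy n) = (case n of 0 \<Rightarrow> 1 | Suc m \<Rightarrow> ennreal (?p m))" for n
  proof (induction n)
    case 0
    have "?u \<in> Cy 0" by (auto simp: Cy_def restrict_def)
    then show ?case using Cy_sets[of 0] by (simp del: PiM_empty)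
  next
    case IH: (Suc n)
    have "emeasure (IT.C 0 (Suc n) ?u) (Cy (Suc n)) =
        (\<integral>\<^sup>+\<omega>. emeasure (IT.eP n \<omega>) (Cy (Suc n)) \<partial>IT.C 0 n ?u)"
      using IT.measurable_eP[of n] IT.measurable_C[of 0 n] und
      by (simp, subst emeasure_bind[where N = "?M (Suc n)"])
         (auto simp: IT.space_C measurable_cong_sets[OF IT.sets_C[OF und] refl] space_PiM)
    also have "\<dots> = (\<integral>\<^sup>+\<omega>. emeasure (step_law K x0 n (restrict x {0..<n})) {x n} *
        indicator (Cy n) \<omega> \<partial>IT.C 0 n ?u)"
      by (rule nn_integral_cong) (use stp IT.space_C[OF und] in auto)
    also have "\<dots> = emeasure (step_law K x0 n (restrict x {0..<n})) {x n} *
        emeasure (IT.C 0 n ?u) (Cy n)"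
      by (rule nn_integral_cmult_indicator) (use IT.sets_C[OF und] Cy_sets[of n] in auto)
    also have "\<dots> = ennreal (?p n)"
    proof (cases n)
      case 0
      then show ?thesis unfolding IH using 0 by (simp add: step_law_def)
    next
      case (Suc m)
      have "emeasure (step_law K x0 n (restrict x {0..<n})) {x n} = ennreal (pmf (K (x m)) (x n))"
        by (simp add: step_law_def Suc emeasure_pmf_single)
      then show ?thesis
        unfolding IH using Suc
        by (simp add: ennreal_mult'[symmetric] prod_nonneg mult.commute)
    qed
    finally show ?case by simp
  qed
  have "{\<omega>. \<forall>s\<le>n. \<omega> s = x s} = IT.PF.emb UNIV {0..<Suc n} (Cy (Suc n))"
  proof -
    have "restrict \<omega> {0..<Suc n} = restrict x {0..<Suc n} \<longleftrightarrow> (\<forall>s\<le>n. \<omega> s = x s)" for \<omega>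
      unfolding fun_eq_iff restrict_def by (metis atLeastLessThan_iff le0 less_Suc_eq_le)
    then show ?thesis by (auto simp: prod_emb_def Cy_def)
  qed
  then have "emeasure (chain_law K x0) {\<omega>. \<forall>s\<le>n. \<omega> s = x s} =
      emeasure IT.PF.lim (IT.PF.emb UNIV {0..<Suc n} (Cy (Suc n)))"
    by (simp only: chain_law_def)
  also have "\<dots> = emeasure (IT.CI {0..<Suc n}) (Cy (Suc n))"
    by (rule IT.lim) auto
  also have "\<dots> = emeasure (IT.C 0 (Suc n) ?u) (IT.PF.emb {0..<Suc n} {0..<Suc n} (Cy (Suc n)))"
    by (rule IT.emeasure_CI) auto
  also have "\<dots> = emeasure (IT.C 0 (Suc n) ?u) (Cy (Suc n))"
    by (subst prod_emb_id) (auto simp: Cy_def)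
  also have "\<dots> = ennreal (?p n)"
    by (simp only: base nat.case)
  finally show ?thesis
    by (simp add: measure_def prod_nonneg)
qed

text \<open>Consistency of the two notions.\<close>

theorem markov_chain_chain_law:
  fixes K :: "'s::countable \<Rightarrow> 's pmf"
  shows "markov_chain (chain_law K x0) UNIV K (\<lambda>t \<omega>. \<omega> t)"
    and "AE \<omega> in chain_law K x0. \<omega> 0 = x0"
proof -
  interpret prob_space "chain_law K x0" by (rule prob_space_chain_law)
  have "\<P>(\<omega> in chain_law K x0. \<omega> (Suc t) = y \<bar> \<forall>s\<le>t. \<omega> s = x s) = pmf (K (x t)) y"
    if pos: "\<P>(\<omega> in chain_law K x0. \<forall>s\<le>t. \<omega> s = x s) > 0" for t x y
  proof -
    let ?x' = "x(Suc t := y)" and ?p = "\<Prod>s<t. pmf (K (x s)) (x (Suc s))"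
    have eq: "{\<omega>. \<omega> (Suc t) = y \<and> (\<forall>s\<le>t. \<omega> s = x s)} = {\<omega>. \<forall>s\<le>Suc t. \<omega> s = ?x' s}"
      by (auto simp: le_Suc_eq)
    have 1: "x 0 = x0" "prob {\<omega>. \<forall>s\<le>t. \<omega> s = x s} = ?p" "?p > 0"
      using pos cylinder_chain_law[of K x0 t x] by (simp_all split: if_splits)
    have "prob {\<omega>. \<forall>s\<le>Suc t. \<omega> s = ?x' s} = ?p * pmf (K (x t)) y"
      using cylinder_chain_law[of K x0 "Suc t" ?x'] 1(1) by simp
    then show ?thesis
      using 1(3) unfolding cond_prob_def by (simp only: space_chain_law UNIV_I simp_thms eq 1(2)) (metis less_irrefl nonzero_mult_div_cancel_left)
  qed
  then show "markov_chain (chain_law K x0) UNIV K (\<lambda>t \<omega>. \<omega> t)"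
    unfolding markov_chain_def
    by (auto intro: prob_space_chain_law coordinate_measurable_chain_law)
  have "prob {\<omega> \<in> space (chain_law K x0). \<omega> 0 = x0} = 1"
    using cylinder_chain_law[of K x0 0 "\<lambda>_. x0"] by simp
  then show "AE \<omega> in chain_law K x0. \<omega> 0 = x0"
    by (rule AE_prob_1[THEN AE_mp]) auto
qed

definition first_return :: "'s \<Rightarrow> (nat \<Rightarrow> 's) \<Rightarrow> enat" where
  "first_return x u = Inf {enat t |t. t \<ge> 1 \<and> u t = x}"

definition irreducible_chain :: "'s set \<Rightarrow> ('s \<Rightarrow> 's pmf) \<Rightarrow> bool" where
  "irreducible_chain S K \<longleftrightarrow>
     (\<forall>x\<in>S. \<forall>y\<in>S. \<exists>n. \<P>(u in chain_law K x. u n = y) > 0)"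

definition null_recurrent_chain :: "'s set \<Rightarrow> ('s \<Rightarrow> 's pmf) \<Rightarrow> bool" where
  "null_recurrent_chain S K \<longleftrightarrow>
     (\<forall>x\<in>S. (AE u in chain_law K x. first_return x u < \<infinity>) \<and>
            (\<integral>\<^sup>+u. ennreal_of_enat (first_return x u) \<partial>chain_law K x) = \<infinity>)"

section \<open>Chains on a strip\<close>

text \<open>The transition function is given as a family \<open>\<phi> l\<close> of distributions on pairs
  \<open>(l', d)\<close>; the paper's $\phi(l,l';d)$ is \<open>pmf (\<phi> l) (l', d)\<close>.
  Only \<open>l \<in> A\<close> is relevant, and from there the chain stays in \<open>A\<close>.\<close>

type_synonym strip_transitions = "nat \<Rightarrow> (nat \<times> int) pmf"

definition strip_transitions_on :: "nat set \<Rightarrow> strip_transitions \<Rightarrow> bool" where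
  "strip_transitions_on A \<phi> \<longleftrightarrow> (\<forall>l\<in>A. set_pmf (\<phi> l) \<subseteq> A \<times> UNIV)"

definition strip_kernel :: "strip_transitions \<Rightarrow> nat \<times> int \<Rightarrow> (nat \<times> int) pmf" where
  "strip_kernel \<phi> = (\<lambda>(l, x). map_pmf (\<lambda>(l', d). (l', x + d)) (\<phi> l))"

lemma pmf_strip_kernel: "pmf (strip_kernel \<phi> (l, x)) (l', x + d) = pmf (\<phi> l) (l', d)"
proof -
  have "inj (\<lambda>(l'::nat, d). (l', x + d))" by (auto simp: inj_on_def)
  from pmf_map_inj'[OF this, of "\<phi> l" "(l', d)"] show ?thesis
    by (simp add: strip_kernel_def)
qed

definition induced_kernel :: "strip_transitions \<Rightarrow> nat \<Rightarrow> nat pmf" where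
  "induced_kernel \<phi> l = map_pmf fst (\<phi> l)"

lemma pmf_induced_kernel:
  "pmf (induced_kernel \<phi> l) l' = (\<Sum>\<^sub>\<infinity>d. pmf (\<phi> l) (l', d))"
proof -
  have "pmf (induced_kernel \<phi> l) l' = measure_pmf.prob (\<phi> l) (Pair l' ` UNIV)"
    unfolding induced_kernel_def pmf_map by (rule arg_cong[where f = "measure _"]) auto
  also have "\<dots> = infsetsum (pmf (\<phi> l)) (Pair l' ` UNIV)"
    by (rule measure_pmf_conv_infsetsum)
  also have "\<dots> = infsum (pmf (\<phi> l)) (Pair l' ` UNIV)"
    by (rule infsetsum_infsum[OF pmf_abs_summable])
  also have "\<dots> = (\<Sum>\<^sub>\<infinity>d. pmf (\<phi> l) (l', d))"
    by (subst infsum_reindex) (auto simp: inj_on_def o_def)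
  finally show ?thesis .
qed

definition pos_part :: "real \<Rightarrow> real" where
  "pos_part x = x * indicator {0<..} x"

definition neg_part :: "real \<Rightarrow> real" where
  "neg_part x = - x * indicator {..<0} x"

text \<open>The conditional law of the increment $V_{t+1} - V_t$ given $U_t = l$, $V_t = z$ is the
  second marginal of \<open>\<phi> l\<close>. The moments are extended nonnegative reals, since they may
  be infinite.\<close>

definition increment_law :: "strip_transitions \<Rightarrow> nat \<Rightarrow> int pmf" where
  "increment_law \<phi> l = map_pmf snd (\<phi> l)"

definition T_plus :: "strip_transitions \<Rightarrow> nat \<Rightarrow> real \<Rightarrow> real" where
  "T_plus \<phi> l x = \<P>(d in increment_law \<phi> l. pos_part (real_of_int d) > x)"

definition M_plus :: "strip_transitions \<Rightarrow> nat \<Rightarrow> real \<Rightarrow> ennreal" where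
  "M_plus \<phi> l \<beta> = (\<integral>\<^sup>+d. ennreal (pos_part (real_of_int d) powr \<beta>) \<partial>increment_law \<phi> l)"

definition M_minus :: "strip_transitions \<Rightarrow> nat \<Rightarrow> real \<Rightarrow> ennreal" where
  "M_minus \<phi> l \<beta> = (\<integral>\<^sup>+d. ennreal (neg_part (real_of_int d) powr \<beta>) \<partial>increment_law \<phi> l)"

end

theory Submission
  imports Defs "HOL-Real_Asymp.Real_Asymp"
begin

text \<open>
  Write \<open>N\<^sub>t\<close> for the number of visits to the \<open>0\<close>-line before time \<open>t\<close>. The
  increments of \<open>V\<close> fall into two groups. The positive parts of those made on the
  \<open>0\<close>-line have a tail of index \<open>\<alpha> < 1\<close>, so \<open>n\<close> of them add up to about \<open>n\<close> to
  the power \<open>1 / \<alpha>\<close>, the order of the largest one. All the other contributions (negative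
  parts, and increments made off the line) have bounded moments of order \<open>\<beta>' = min \<beta> 1\<close>,
  so up to time \<open>t\<close> they add up to at most about \<open>t\<close> to the power \<open>1 / \<beta>'\<close>. The
  tail index \<open>\<gamma>\<close> of the return times makes \<open>N\<^sub>t\<close> of order \<open>t\<close> to the power \<open>\<gamma>\<close>.
  So the first group contributes the exponent \<open>\<gamma> / \<alpha>\<close>, and \<open>\<alpha> < \<gamma> \<beta>'\<close> says
  precisely that this exceeds \<open>1 / \<beta>'\<close>.

  To make this rigorous without extracting independent sequences along stopping times, every
  estimate is reduced to a single identity. For a nonnegative functional \<open>a\<close> of the history up
  to time \<open>t\<close>, the factor \<open>g (X t) (X (Suc t))\<close> in an expectation can be replaced by its
  integral under the kernel (\<open>nn_integral_step\<close>), and iterating this gives the probability of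
  avoiding a set for \<open>m\<close> steps (\<open>nn_integral_avoid\<close>).

  For the upper bounds: if the expectation of a weighted series of nonnegative terms is finite then
  the series converges almost surely, and for an exponent at most \<open>1\<close> the subadditivity of
  powers turns this into a growth bound for the partial sums (\<open>AE_weighted_sum_finite\<close>,
  \<open>sum_growth_of_weighted_series\<close>). For the jumps from the \<open>0\<close>-line the weights need a
  bound on the expected number of visits: at most one visit up to time \<open>t\<close> is the last one, so
  this expected number times the probability of no return within \<open>t\<close> steps is at most \<open>1\<close>
  (\<open>expected_visits_times_tail_le_1\<close>).

  For the lower bound: \<open>N\<^sub>t\<close> cannot be much smaller than \<open>t\<close> to the power \<open>\<gamma>\<close>,
  since fewer excursions would not be long enough to fill the time up to \<open>t\<close>
  (\<open>AE_visits_ge_powr\<close>). With that many visits, an exponential supermartingale shows that no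
  jump from the line being large is so unlikely that the Borel-Cantelli lemma applies at the
  deterministic times \<open>t\<close> (\<open>AE_eventually_large_jump\<close>). A single large jump then outweighs
  all the other contributions.
\<close>

section \<open>Power bounds, series and moments\<close>

text \<open>
  The default value \<open>ln 0 = 0\<close> makes the quotient vanish where \<open>f\<close> does, so a
  nonzero limit forces \<open>f\<close> to be positive eventually.
\<close>
lemma eventually_powr_bounds_of_log_ratio:
  fixes f g :: "'a \<Rightarrow> real"
  assumes lim: "((\<lambda>x. ln (f x) / ln (g x)) \<longlongrightarrow> - c) F"
    and g: "filterlim g at_top F" and f: "\<And>x. 0 \<le> f x"
    and "0 < c" "a < c" "c < b"
  shows "\<forall>\<^sub>F x in F. g x powr - b \<le> f x \<and> f x \<le> g x powr - a"
proof -
  have 1: "\<forall>\<^sub>F x in F. - b < ln (f x) / ln (g x)"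
    using assms by (intro order_tendstoD(1)[OF lim]) simp
  have 2: "\<forall>\<^sub>F x in F. ln (f x) / ln (g x) < - max a 0"
    using assms by (intro order_tendstoD(2)[OF lim]) simp
  have 3: "\<forall>\<^sub>F x in F. 1 < g x"
    using g filterlim_at_top_dense by blast
  show ?thesis
    using 1 2 3
  proof eventually_elim
    case (elim x)
    have ln_g: "0 < ln (g x)" and g_pos: "0 < g x" using elim by simp_all
    have "ln (f x) \<noteq> 0" using elim(2) by auto
    with f[of x] have f_pos: "0 < f x" by (cases "f x = 0") auto
    have "- b * ln (g x) < ln (f x)" using elim(1) ln_g by (simp add: field_simps)
    moreover have "ln (f x) < - a * ln (g x)"
    proof -
      have "ln (f x) / ln (g x) < - a" using elim(2) by linarith
      then show ?thesis using ln_g by (simp add: field_simps)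
    qed
    ultimately have "exp (- b * ln (g x)) \<le> exp (ln (f x))" "exp (ln (f x)) \<le> exp (- a * ln (g x))"
      by simp_all
    then show ?case using f_pos g_pos by (simp add: powr_def)
  qed
qed

lemma summable_Suc_powr: "0 < e \<Longrightarrow> summable (\<lambda>n. real (Suc n) powr (- 1 - e))"
  using summable_Suc_iff[of "\<lambda>n. real n powr (- 1 - e)"] summable_real_powr_iff[of "- 1 - e"]
  by simp

lemma summable_powr_times_tail:
  fixes T :: "nat \<Rightarrow> real"
  assumes T: "\<And>n. 0 \<le> T n" and ev: "\<forall>\<^sub>F n in sequentially. T n \<le> real n powr - b" and "a < b"
  shows "summable (\<lambda>n. real (Suc n) powr (a - 1) * T n)"
proof (rule summable_comparison_test_bigo)
  show "summable (\<lambda>n. norm (real (Suc n) powr (- 1 - (b - a))))"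
    using summable_Suc_powr[of "b - a"] \<open>a < b\<close> by simp
  have "(\<lambda>n. real (Suc n) powr (a - 1) * T n) \<in> O(\<lambda>n. real (Suc n) powr (a - 1) * real n powr - b)"
    using ev T by (intro landau_o.big_mono) (auto elim!: eventually_mono intro!: mult_left_mono)
  also have "(\<lambda>n. real (Suc n) powr (a - 1) * real n powr - b) \<in> O(\<lambda>n. real (Suc n) powr (- 1 - (b - a)))"
    by real_asymp
  finally show "(\<lambda>n. real (Suc n) powr (a - 1) * T n) \<in> O(\<lambda>n. real (Suc n) powr (- 1 - (b - a)))" .
qed

text \<open>
  Each of the \<open>j\<close> terms is at least \<open>j\<close> to the power \<open>a - 1\<close>, because the exponent
  \<open>a - 1\<close> is not positive. This is a discrete substitute for writing a moment as an integral
  of the tail.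
\<close>
lemma powr_le_sum_powr:
  assumes "a \<le> 1"
  shows "real j powr a \<le> (\<Sum>n<j. real (Suc n) powr (a - 1))"
proof -
  have "real j powr (a - 1) \<le> real (Suc n) powr (a - 1)" if "n < j" for n
    using that assms by (intro powr_mono2') auto
  then have "(\<Sum>n<j. real j powr (a - 1)) \<le> (\<Sum>n<j. real (Suc n) powr (a - 1))"
    by (intro sum_mono) simp
  moreover have "(\<Sum>n<j. real j powr (a - 1)) = real j powr a"
    by (cases "j = 0") (simp_all add: powr_diff)
  ultimately show ?thesis by simp
qed

text \<open>
  Subadditivity of \<open>x powr \<beta>\<close> for \<open>\<beta> \<le> 1\<close>. With \<open>S\<close> the sum on the right, each
  \<open>b s powr \<beta>\<close> is at most \<open>S\<close>, so \<open>b s\<close> is at most \<open>b s powr \<beta>\<close> times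
  \<open>S powr (1 / \<beta> - 1)\<close>.
\<close>
lemma sum_le_powr_sum_powr:
  fixes b :: "'a \<Rightarrow> real"
  assumes "finite I" and b: "\<And>s. s \<in> I \<Longrightarrow> 0 \<le> b s" and \<beta>: "0 < \<beta>" "\<beta> \<le> 1"
  shows "(\<Sum>s\<in>I. b s) \<le> (\<Sum>s\<in>I. b s powr \<beta>) powr (1 / \<beta>)"
proof -
  let ?S = "\<Sum>s\<in>I. b s powr \<beta>"
  have le: "b s \<le> b s powr \<beta> * ?S powr (1 / \<beta> - 1)" if "s \<in> I" for s
  proof (cases "b s = 0")
    case False
    then have pos: "0 < b s" using b[OF that] by simp
    have "b s powr \<beta> \<le> ?S" using assms that by (intro member_le_sum) auto
    then have "(b s powr \<beta>) powr (1 / \<beta> - 1) \<le> ?S powr (1 / \<beta> - 1)"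
      using \<beta> by (intro powr_mono2) auto
    moreover have "b s powr \<beta> * (b s powr \<beta>) powr (1 / \<beta> - 1) = b s"
      using pos \<beta> by (simp add: powr_powr powr_add[symmetric] algebra_simps)
    ultimately show ?thesis
      by (metis mult_left_mono powr_ge_zero)
  qed simp
  have "(\<Sum>s\<in>I. b s) \<le> (\<Sum>s\<in>I. b s powr \<beta> * ?S powr (1 / \<beta> - 1))"
    by (intro sum_mono le)
  also have "\<dots> = ?S * ?S powr (1 / \<beta> - 1)" by (simp add: sum_distrib_right)
  also have "\<dots> = ?S powr (1 / \<beta>)"
  proof (cases "?S = 0")
    case False
    moreover have "0 \<le> ?S" by (intro sum_nonneg) simp
    ultimately show ?thesis by (simp add: powr_diff)
  qed simp
  finally show ?thesis .
qed

text \<open>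
  For \<open>s < t\<close> the weight of the \<open>s\<close>-th term is at least \<open>t powr - \<kappa>\<close>, which bounds
  the sum of the \<open>\<beta>\<close>-th powers; subadditivity does the rest. This replaces a
  Borel-Cantelli argument along a geometric subsequence.
\<close>
lemma sum_growth_of_weighted_series:
  fixes b :: "nat \<Rightarrow> real"
  assumes b: "\<And>s. 0 \<le> b s" and \<beta>: "0 < \<beta>" "\<beta> \<le> 1" and \<kappa>: "0 \<le> \<kappa>"
    and fin: "(\<Sum>s. ennreal (real (Suc s) powr - \<kappa> * b s powr \<beta>)) \<noteq> \<infinity>"
  obtains c where "\<And>t. (\<Sum>s<t. b s) \<le> c * real t powr (\<kappa> / \<beta>)"
proof -
  let ?f = "\<lambda>s. real (Suc s) powr - \<kappa> * b s powr \<beta>"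
  have summ: "summable ?f" using fin by (intro summable_suminf_not_top) auto
  define z where "z = suminf ?f"
  have z: "0 \<le> z" unfolding z_def by (intro suminf_nonneg summ) simp
  have "(\<Sum>s<t. b s) \<le> z powr (1 / \<beta>) * real t powr (\<kappa> / \<beta>)" for t
  proof -
    have "(\<Sum>s<t. b s powr \<beta>) \<le> (\<Sum>s<t. real t powr \<kappa> * ?f s)"
    proof (intro sum_mono)
      fix s assume "s \<in> {..<t}"
      then have "real (Suc s) powr \<kappa> \<le> real t powr \<kappa>" using \<kappa> by (intro powr_mono2) auto
      then have "1 \<le> real t powr \<kappa> * real (Suc s) powr - \<kappa>"
        by (simp add: powr_minus field_simps)
      then show "b s powr \<beta> \<le> real t powr \<kappa> * ?f s"
        by (simp add: mult.assoc[symmetric] mult_right_mono mult_le_cancel_right1)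
    qed
    also have "\<dots> = real t powr \<kappa> * (\<Sum>s<t. ?f s)" by (simp add: sum_distrib_left)
    also have "\<dots> \<le> real t powr \<kappa> * z"
      unfolding z_def by (intro mult_left_mono sum_le_suminf summ) auto
    finally have S: "(\<Sum>s<t. b s powr \<beta>) \<le> real t powr \<kappa> * z" .
    have "(\<Sum>s<t. b s) \<le> (\<Sum>s<t. b s powr \<beta>) powr (1 / \<beta>)"
      using b \<beta> by (intro sum_le_powr_sum_powr) auto
    also have "\<dots> \<le> (real t powr \<kappa> * z) powr (1 / \<beta>)"
      using \<beta> S by (intro powr_mono2 sum_nonneg) auto
    also have "\<dots> = z powr (1 / \<beta>) * real t powr (\<kappa> / \<beta>)"
      using z by (simp add: powr_mult powr_powr)
    finally show ?thesis .
  qed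
  then show ?thesis by (rule that)
qed

text \<open>
  Summation by parts without differences of powers: the weight \<open>real (Suc s) powr - \<kappa>\<close> is
  at most a constant times the sum of \<open>real (Suc t) powr (- \<kappa> - 1)\<close> over \<open>s \<le> t \<le> 2 * s\<close>,
  since these \<open>Suc s\<close> terms are comparable. Exchanging the two sums leaves the partial sums of
  \<open>p\<close>, each with a weight that makes the series converge.
\<close>
lemma summable_powr_weights:
  fixes p :: "nat \<Rightarrow> real"
  assumes p: "\<And>s. 0 \<le> p s" and ev: "\<forall>\<^sub>F t in sequentially. (\<Sum>s\<le>t. p s) \<le> real t powr b"
    and b: "0 < b" "b < \<kappa>"
  shows "summable (\<lambda>s. real (Suc s) powr - \<kappa> * p s)"
proof -
  let ?G = "\<lambda>t. \<Sum>s\<le>t. p s" and ?v = "\<lambda>t. real (Suc t) powr (- \<kappa> - 1)"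
  have G_mono: "?G s \<le> ?G t" if "s \<le> t" for s t
    using that p by (intro sum_mono2) auto
  (* Before t0 the bound on the partial sums is unavailable; the constant c absorbs those terms. *)
  obtain t0 where t0: "\<And>t. t0 \<le> t \<Longrightarrow> ?G t \<le> real t powr b"
    using ev by (auto simp: eventually_sequentially)
  define c where "c = 1 + ?G t0"
  have G0: "0 \<le> ?G t" for t using p by (intro sum_nonneg)
  have c: "1 \<le> c" unfolding c_def using G0[of t0] by simp
  have G: "?G t \<le> c * real (Suc t) powr b" for t
  proof (cases "t0 \<le> t")
    case True
    then have "?G t \<le> real t powr b" by (rule t0)
    also have "\<dots> \<le> 1 * real (Suc t) powr b" using b by (simp add: powr_mono2)
    also have "\<dots> \<le> c * real (Suc t) powr b" using c by (intro mult_right_mono) auto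
    finally show ?thesis .
  next
    case False
    then have "?G t \<le> c" using G_mono[of t t0] by (simp add: c_def)
    also have "\<dots> \<le> c * real (Suc t) powr b"
      using c b by (simp add: ge_one_powr_ge_zero)
    finally show ?thesis .
  qed
  have weight: "real (Suc s) powr - \<kappa> \<le> 2 powr (\<kappa> + 1) * (\<Sum>t\<in>{s..2 * s}. ?v t)" for s
  proof -
    have "(\<Sum>t\<in>{s..2 * s}. (2 * real (Suc s)) powr (- \<kappa> - 1)) \<le> (\<Sum>t\<in>{s..2 * s}. ?v t)"
      using b by (intro sum_mono powr_mono2') auto
    moreover have "(\<Sum>t\<in>{s..2 * s}. (2 * real (Suc s)) powr (- \<kappa> - 1)) =
        2 powr (- \<kappa> - 1) * real (Suc s) powr - \<kappa>"
    proof -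
      have "real (Suc s) * real (Suc s) powr (- \<kappa> - 1) = real (Suc s) powr - \<kappa>"
        by (subst powr_mult_base) auto
      moreover have "(2 * real (Suc s)) powr (- \<kappa> - 1) =
          2 powr (- \<kappa> - 1) * real (Suc s) powr (- \<kappa> - 1)"
        by (rule powr_mult)
      ultimately show ?thesis by (simp only: sum_constant card_atLeastAtMost) (simp add: mult.left_commute)
    qed
    ultimately have "2 powr (\<kappa> + 1) * (2 powr (- \<kappa> - 1) * real (Suc s) powr - \<kappa>) \<le>
        2 powr (\<kappa> + 1) * (\<Sum>t\<in>{s..2 * s}. ?v t)"
      by (intro mult_left_mono) auto
    then show ?thesis
      by (simp add: mult.assoc[symmetric] powr_add[symmetric])
  qed
  have summ: "summable (\<lambda>t. ?v t * (c * real (Suc t) powr b))"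
  proof -
    have "(\<lambda>t. ?v t * (c * real (Suc t) powr b)) = (\<lambda>t. c * real (Suc t) powr (- 1 - (\<kappa> - b)))"
      by (simp add: fun_eq_iff powr_add[symmetric] algebra_simps)
    then show ?thesis
      using b by (simp only:) (intro summable_mult summable_Suc_powr, simp)
  qed
  show ?thesis
  proof (rule summableI_nonneg_bounded)
    fix n
    have "(\<Sum>s<n. real (Suc s) powr - \<kappa> * p s)
        \<le> (\<Sum>s<n. 2 powr (\<kappa> + 1) * (\<Sum>t\<in>{s..2 * s}. ?v t) * p s)"
      using p by (intro sum_mono mult_right_mono weight) auto
    also have "\<dots> \<le> (\<Sum>s<n. 2 powr (\<kappa> + 1) * (\<Sum>t<2 * n. if s \<le> t then ?v t else 0) * p s)"
    proof (intro sum_mono mult_right_mono mult_left_mono)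
      fix s assume s: "s \<in> {..<n}"
      have "(\<Sum>t\<in>{s..2 * s}. ?v t) = (\<Sum>t\<in>{s..2 * s}. if s \<le> t then ?v t else 0)"
        by (intro sum.cong) auto
      also have "\<dots> \<le> (\<Sum>t<2 * n. if s \<le> t then ?v t else 0)"
        using s by (intro sum_mono2) auto
      finally show "(\<Sum>t\<in>{s..2 * s}. ?v t) \<le> (\<Sum>t<2 * n. if s \<le> t then ?v t else 0)" .
    qed (use p in auto)
    also have "\<dots> = 2 powr (\<kappa> + 1) * (\<Sum>s<n. \<Sum>t<2 * n. if s \<le> t then ?v t * p s else 0)"
      by (simp add: sum_distrib_left sum_distrib_right mult.assoc if_distrib[of "\<lambda>x. x * _"]
          if_distrib[of "\<lambda>x. _ * x"] cong: if_cong)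
    also have "\<dots> = 2 powr (\<kappa> + 1) * (\<Sum>t<2 * n. \<Sum>s<n. if s \<le> t then ?v t * p s else 0)"
      by (subst sum.swap) simp
    also have "\<dots> \<le> 2 powr (\<kappa> + 1) * (\<Sum>t<2 * n. ?v t * (c * real (Suc t) powr b))"
    proof (intro mult_left_mono sum_mono)
      fix t
      have "(\<Sum>s<n. if s \<le> t then ?v t * p s else 0) = (\<Sum>s\<in>{..<n} \<inter> {..t}. ?v t * p s)"
        by (simp only: sum.inter_restrict finite_lessThan atMost_iff)
      also have "\<dots> \<le> (\<Sum>s\<le>t. ?v t * p s)" using p by (intro sum_mono2) auto
      also have "\<dots> = ?v t * ?G t" by (simp add: sum_distrib_left)
      also have "\<dots> \<le> ?v t * (c * real (Suc t) powr b)" by (intro mult_left_mono G) auto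
      finally show "(\<Sum>s<n. if s \<le> t then ?v t * p s else 0) \<le> ?v t * (c * real (Suc t) powr b)" .
    qed auto
    also have "\<dots> \<le> 2 powr (\<kappa> + 1) * (\<Sum>t. ?v t * (c * real (Suc t) powr b))"
      using c by (intro mult_left_mono sum_le_suminf summ) auto
    finally show "(\<Sum>s<n. real (Suc s) powr - \<kappa> * p s)
        \<le> 2 powr (\<kappa> + 1) * (\<Sum>t. ?v t * (c * real (Suc t) powr b))" .
  qed (use p in auto)
qed

lemma summable_exp_neg_powr: "0 < \<delta> \<Longrightarrow> summable (\<lambda>t. exp (- (real t powr \<delta>)))"
proof (rule summable_comparison_test_bigo)
  show "summable (\<lambda>t. norm (real t powr - 2))"
    using summable_real_powr_iff[of "- 2"] by simp
  assume "0 < \<delta>"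
  then show "(\<lambda>t. exp (- (real t powr \<delta>))) \<in> O(\<lambda>t. real t powr - 2)"
    by real_asymp
qed

lemma log_limit_of_powr_bounds:
  fixes v :: "nat \<Rightarrow> real"
  assumes \<epsilon>: "0 < \<epsilon>" "\<epsilon> < L"
    and bounds: "\<And>n. \<forall>\<^sub>F t in sequentially.
      real t powr (L - \<epsilon> / real (Suc n)) \<le> v t \<and> v t \<le> real t powr (L + \<epsilon> / real (Suc n))"
  shows "filterlim v at_top sequentially" and "(\<lambda>t. ln (v t) / ln (real t)) \<longlonglongrightarrow> L"
proof -
  have "filterlim (\<lambda>t. real t powr (L - \<epsilon>)) at_top sequentially"
    using \<epsilon> by real_asymp
  then show "filterlim v at_top sequentially"
    by (rule filterlim_at_top_mono) (use bounds[of 0] in \<open>auto elim: eventually_mono\<close>)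
  show "(\<lambda>t. ln (v t) / ln (real t)) \<longlonglongrightarrow> L"
  proof (rule tendstoI)
    fix e :: real assume "0 < e"
    then obtain n where n: "inverse (real (Suc n)) < e / \<epsilon>"
      using reals_Archimedean[of "e / \<epsilon>"] \<epsilon> by auto
    have small: "\<epsilon> / real (Suc n) < e" using n \<epsilon> by (simp add: field_simps)
    show "\<forall>\<^sub>F t in sequentially. dist (ln (v t) / ln (real t)) L < e"
      using bounds[of n] eventually_gt_at_top[of 1]
    proof eventually_elim
      case (elim t)
      let ?l = "ln (real t)"
      have l: "0 < ?l" using elim by simp
      note lo = elim(1)[THEN conjunct1] and hi = elim(1)[THEN conjunct2]
      have pos: "0 < real t powr (L - \<epsilon> / real (Suc n))" using elim by simp
      note pos' = less_le_trans[OF pos lo]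
      have ln_eq: "ln (real t powr y) = y * ?l" for y
        using elim by (simp add: ln_powr)
      have ln_lo: "ln (real t powr (L - \<epsilon> / real (Suc n))) \<le> ln (v t)"
        using lo pos pos' by (simp only: ln_le_cancel_iff)
      have ln_hi: "ln (v t) \<le> ln (real t powr (L + \<epsilon> / real (Suc n)))"
        using hi pos' less_le_trans[OF pos' hi] by (simp only: ln_le_cancel_iff)
      from ln_lo[unfolded ln_eq] ln_hi[unfolded ln_eq]
      have "L - \<epsilon> / real (Suc n) \<le> ln (v t) / ?l" "ln (v t) / ?l \<le> L + \<epsilon> / real (Suc n)"
        using l by (simp_all add: pos_le_divide_eq pos_divide_le_eq)
      then show ?case using small by (simp add: dist_real_def abs_less_iff)
    qed
  qed
qed

lemma nn_moment_le_tail_series: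
  fixes j :: "'a \<Rightarrow> nat" and p :: "'a pmf"
  assumes "a \<le> 1"
  shows "(\<integral>\<^sup>+x. ennreal (real (j x) powr a) \<partial>p) \<le>
    (\<Sum>n. ennreal (real (Suc n) powr (a - 1) * measure_pmf.prob p {x. n < j x}))"
proof -
  have "(\<integral>\<^sup>+x. ennreal (real (j x) powr a) \<partial>p) \<le>
      (\<integral>\<^sup>+x. (\<Sum>n. ennreal (real (Suc n) powr (a - 1)) * indicator {x. n < j x} x) \<partial>p)"
  proof (intro nn_integral_mono)
    fix x
    have "ennreal (real (j x) powr a) \<le> (\<Sum>n<j x. ennreal (real (Suc n) powr (a - 1)))"
      using powr_le_sum_powr[OF assms, of "j x"] by (simp add: sum_ennreal ennreal_leI)
    also have "\<dots> = (\<Sum>n<j x. ennreal (real (Suc n) powr (a - 1)) * indicator {x. n < j x} x)"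
      by (intro sum.cong) auto
    also have "\<dots> \<le> (\<Sum>n. ennreal (real (Suc n) powr (a - 1)) * indicator {x. n < j x} x)"
      by (intro sum_le_suminf) auto
    finally show "ennreal (real (j x) powr a) \<le>
      (\<Sum>n. ennreal (real (Suc n) powr (a - 1)) * indicator {x. n < j x} x)" .
  qed
  also have "\<dots> = (\<Sum>n. ennreal (real (Suc n) powr (a - 1)) * emeasure p {x. n < j x})"
    by (subst nn_integral_suminf) (auto simp: nn_integral_cmult_indicator)
  finally show ?thesis
    by (simp add: measure_pmf.emeasure_eq_measure ennreal_mult)
qed

text \<open>
  Lets \<open>\<beta>\<close> be replaced by \<open>min \<beta> 1\<close>, so that powers are subadditive.
\<close>
lemma nn_moment_min_1_le:
  fixes f :: "'a \<Rightarrow> real" and p :: "'a pmf"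
  assumes f: "\<And>x. 0 \<le> f x" and "0 < \<beta>"
  shows "(\<integral>\<^sup>+x. ennreal (f x powr min \<beta> 1) \<partial>p) \<le> 1 + (\<integral>\<^sup>+x. ennreal (f x powr \<beta>) \<partial>p)"
proof -
  have "f x powr min \<beta> 1 \<le> 1 + f x powr \<beta>" for x
  proof (cases "f x \<le> 1")
    case True
    then have "f x powr min \<beta> 1 \<le> 1" using f assms by (intro powr_le1) auto
    then show ?thesis by (simp add: add_increasing2)
  next
    case False
    then have "f x powr min \<beta> 1 \<le> f x powr \<beta>" by (intro powr_mono) auto
    then show ?thesis by simp
  qed
  then have "(\<integral>\<^sup>+x. ennreal (f x powr min \<beta> 1) \<partial>p) \<le> (\<integral>\<^sup>+x. 1 + ennreal (f x powr \<beta>) \<partial>p)"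
    by (intro nn_integral_mono) (simp add: ennreal_leI flip: ennreal_1 ennreal_plus)
  also have "\<dots> = 1 + (\<integral>\<^sup>+x. ennreal (f x powr \<beta>) \<partial>p)"
    by (subst nn_integral_add) auto
  finally show ?thesis .
qed

section \<open>Avoidance probabilities and visit counts\<close>

text \<open>
  \<open>avoid K Z m l\<close> is the probability that the chain with kernel \<open>K\<close> started at \<open>l\<close> stays
  outside \<open>Z\<close> at the times \<open>1, ..., m\<close>; the position at time \<open>0\<close> is not constrained, so
  that on \<open>Z\<close> this is the tail of the return time. The recursion is on the first step.
\<close>
primrec avoid :: "('s \<Rightarrow> 's pmf) \<Rightarrow> 's set \<Rightarrow> nat \<Rightarrow> 's \<Rightarrow> ennreal" where
  "avoid K Z 0 l = 1"
| "avoid K Z (Suc m) l = (\<integral>\<^sup>+y. indicator (- Z) y * avoid K Z m y \<partial>K l)"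

lemma avoid_antimono: "m \<le> n \<Longrightarrow> avoid K Z n l \<le> avoid K Z m l"
proof (rule lift_Suc_antimono_le[of "\<lambda>n. avoid K Z n l"])
  show "avoid K Z (Suc n) l \<le> avoid K Z n l" for n
  proof (induction n arbitrary: l)
    case 0
    have "avoid K Z 1 l \<le> (\<integral>\<^sup>+y. 1 \<partial>K l)"
      by (simp del: nn_integral_indicator nn_integral_const, intro nn_integral_mono)
        (simp add: indicator_def)
    also have "\<dots> = 1" by simp
    finally show ?case by (simp del: avoid.simps(2) add: avoid.simps(1))
  next
    case (Suc n)
    show ?case
      by (subst (1 2) avoid.simps(2)) (intro nn_integral_mono mult_left_mono Suc zero_le)
  qed
qed

lemma avoid_le_1: "avoid K Z m l \<le> 1"
  using avoid_antimono[of 0 m K Z l] by simp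

text \<open>
  Certainty of hitting \<open>Z\<close> propagates along possible steps: a chain that reaches \<open>l'\<close> with
  positive probability and then avoids \<open>Z\<close> forever would avoid it from \<open>l\<close> as well.
\<close>
lemma avoid_tendsto_0_step:
  assumes lim: "(\<lambda>m. avoid K Z m l) \<longlonglongrightarrow> 0" and l': "l' \<in> set_pmf (K l)" "l' \<notin> Z"
  shows "(\<lambda>m. avoid K Z m l') \<longlonglongrightarrow> 0"
proof -
  let ?q = "pmf (K l) l'"
  have q: "0 < ?q" using l' by (simp add: pmf_positive)
  have "ennreal ?q * avoid K Z m l' \<le> avoid K Z (Suc m) l" for m
  proof -
    have "ennreal ?q * avoid K Z m l' =
        (\<integral>\<^sup>+y. avoid K Z m l' * indicator {l'} y \<partial>K l)"
      by (subst nn_integral_cmult_indicator) (auto simp: emeasure_pmf_single mult.commute)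
    also have "\<dots> \<le> avoid K Z (Suc m) l"
      unfolding avoid.simps using l' by (intro nn_integral_mono) (auto simp: indicator_def)
    finally show ?thesis .
  qed
  then have le: "avoid K Z m l' \<le> ennreal (1 / ?q) * avoid K Z (Suc m) l" for m
  proof -
    have "avoid K Z m l' = ennreal (1 / ?q) * (ennreal ?q * avoid K Z m l')"
      using q by (simp add: mult.assoc[symmetric] ennreal_mult[symmetric])
    also have "\<dots> \<le> ennreal (1 / ?q) * avoid K Z (Suc m) l"
      by (intro mult_left_mono) (use \<open>ennreal ?q * avoid K Z m l' \<le> avoid K Z (Suc m) l\<close> in auto)
    finally show ?thesis .
  qed
  have "(\<lambda>m. ennreal (1 / ?q) * avoid K Z (Suc m) l) \<longlonglongrightarrow> ennreal (1 / ?q) * 0"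
    by (intro ennreal_tendsto_cmult LIMSEQ_Suc lim) simp
  then show ?thesis
    by (intro tendsto_sandwich[where f = "\<lambda>_. 0" and g = "\<lambda>m. avoid K Z m l'"])
      (use le in auto)
qed

definition visits :: "'s set \<Rightarrow> nat \<Rightarrow> (nat \<Rightarrow> 's) \<Rightarrow> nat" where
  "visits Z t x = card {s. s < t \<and> x s \<in> Z}"

lemma visits_0 [simp]: "visits Z 0 x = 0"
  by (simp add: visits_def)

lemma visits_Suc: "visits Z (Suc t) x = visits Z t x + of_bool (x t \<in> Z)"
proof -
  have "{s. s < Suc t \<and> x s \<in> Z} = {s. s < t \<and> x s \<in> Z} \<union> (if x t \<in> Z then {t} else {})"
    by (auto simp: less_Suc_eq)
  then show ?thesis by (simp add: visits_def)
qed

lemma visits_mono: "s \<le> t \<Longrightarrow> visits Z s x \<le> visits Z t x"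
  unfolding visits_def by (intro card_mono) auto

lemma visits_cong: "(\<And>s. s < t \<Longrightarrow> x s = y s) \<Longrightarrow> visits Z t x = visits Z t y"
  unfolding visits_def by (intro arg_cong[where f = card]) auto

text \<open>
  The count \<open>visits Z (Suc s) x\<close> runs through \<open>1, 2, ...\<close> at the successive visits, so
  weights that depend on it have a total bounded uniformly over all paths, however frequent the
  visits are.
\<close>
lemma sum_over_visits:
  "(\<Sum>s<t. if x s \<in> Z then f (visits Z (Suc s) x) else (0::real)) = (\<Sum>k=1..visits Z t x. f k)"
  by (induction t) (auto simp: visits_Suc)

section \<open>Expectations along a Markov chain with countable state space\<close>

lemma nn_integral_countable_valued:
  fixes Y :: "'w \<Rightarrow> 'a::countable"
  assumes Y [measurable]: "Y \<in> M \<rightarrow>\<^sub>M count_space UNIV"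
  shows "(\<integral>\<^sup>+\<omega>. F (Y \<omega>) \<partial>M) =
    (\<integral>\<^sup>+z. emeasure M {\<omega> \<in> space M. Y \<omega> = z} * F z \<partial>count_space UNIV)"
proof -
  have "distr M (count_space UNIV) Y =
      density (count_space UNIV) (\<lambda>z. emeasure M {\<omega> \<in> space M. Y \<omega> = z})"
  proof (rule measure_eqI_countable[where A = UNIV])
    fix z
    have "Y -` {z} \<inter> space M = {\<omega> \<in> space M. Y \<omega> = z}" by auto
    then show "emeasure (distr M (count_space UNIV) Y) {z} =
        emeasure (density (count_space UNIV) (\<lambda>z. emeasure M {\<omega> \<in> space M. Y \<omega> = z})) {z}"
      by (simp add: emeasure_distr emeasure_density nn_integral_count_space_indicator[symmetric])
  qed auto
  then show ?thesis
    using nn_integral_distr[OF Y, of F] by (simp add: nn_integral_density)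
qed

text \<open>
  Adaptedness, for functionals of a path. With countably many states it takes the place of
  measurability with respect to the natural filtration.
\<close>
definition determined_by :: "nat \<Rightarrow> ((nat \<Rightarrow> 's) \<Rightarrow> 'b) \<Rightarrow> bool" where
  "determined_by t a \<longleftrightarrow> (\<forall>x y. (\<forall>i\<le>t. x i = y i) \<longrightarrow> a x = a y)"

locale countable_markov_chain = prob_space M
  for M :: "'w measure" +
  fixes S :: "'s::countable set" and K :: "'s \<Rightarrow> 's pmf" and X :: "nat \<Rightarrow> 'w \<Rightarrow> 's"
  assumes chain: "markov_chain M S K X"
begin

abbreviation (input) path :: "'w \<Rightarrow> nat \<Rightarrow> 's" where
  "path \<omega> \<equiv> \<lambda>i. X i \<omega>"

lemma X_measurable [measurable]: "X t \<in> M \<rightarrow>\<^sub>M count_space UNIV"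
  using chain by (simp add: markov_chain_def)

lemma X_in: "\<omega> \<in> space M \<Longrightarrow> X t \<omega> \<in> S"
  using chain by (simp add: markov_chain_def)

text \<open>
  The history is encoded as a list because lists over a countable type form a countable type, which
  makes expectations of functionals of the history into sums over all lists.
\<close>
definition history :: "nat \<Rightarrow> 'w \<Rightarrow> 's list" where
  "history t \<omega> = map (path \<omega>) [0..<Suc t]"

lemma history_eq_iff: "history t \<omega> = h \<longleftrightarrow> length h = Suc t \<and> (\<forall>s\<le>t. X s \<omega> = h ! s)"
  unfolding history_def list_eq_iff_nth_eq by (auto simp del: upt_Suc simp: less_Suc_eq_le)

lemma last_history: "last (history t \<omega>) = X t \<omega>"
  by (simp add: history_def)

lemma history_measurable [measurable]: "history t \<in> M \<rightarrow>\<^sub>M count_space UNIV"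
proof (subst measurable_count_space_eq2_countable, simp, safe)
  fix h
  have "history t -` {h} \<inter> space M = {\<omega> \<in> space M. length h = Suc t \<and> (\<forall>s\<le>t. X s \<omega> = h ! s)}"
    using history_eq_iff by auto
  also have "\<dots> \<in> sets M" by measurable
  finally show "history t -` {h} \<inter> space M \<in> sets M" .
qed

lemma determined_history:
  "determined_by t a \<Longrightarrow> a (path \<omega>) = a (nth (history t \<omega>))"
  using history_eq_iff[of t \<omega> "history t \<omega>"] unfolding determined_by_def by simp

lemma determined_measurable:
  assumes "determined_by t a"
  shows "(\<lambda>\<omega>. a (path \<omega>)) \<in> M \<rightarrow>\<^sub>M count_space UNIV"
proof -
  have "(\<lambda>h. a (nth h)) \<in> count_space UNIV \<rightarrow>\<^sub>M count_space UNIV" by simp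
  from measurable_compose[OF history_measurable[of t] this] show ?thesis
    by (simp add: determined_history[OF assms])
qed

lemma determined_borel_measurable:
  fixes a :: "(nat \<Rightarrow> 's) \<Rightarrow> 'b::topological_space"
  assumes "determined_by t a"
  shows "(\<lambda>\<omega>. a (path \<omega>)) \<in> borel_measurable M"
proof -
  have "(\<lambda>h. a (nth h)) \<in> count_space UNIV \<rightarrow>\<^sub>M borel" by simp
  from measurable_compose[OF history_measurable[of t] this] show ?thesis
    by (simp add: determined_history[OF assms])
qed

lemma emeasure_history_step:
  "emeasure M {\<omega> \<in> space M. (history t \<omega>, X (Suc t) \<omega>) = (h, y)} =
    emeasure M {\<omega> \<in> space M. history t \<omega> = h} * ennreal (pmf (K (last h)) y)"
proof (cases "length h = Suc t")
  case True
  let ?H = "{\<omega> \<in> space M. \<forall>s\<le>t. X s \<omega> = h ! s}"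
  let ?E = "{\<omega> \<in> space M. X (Suc t) \<omega> = y \<and> (\<forall>s\<le>t. X s \<omega> = h ! s)}"
  have last: "last h = h ! t" using True by (cases h rule: rev_cases) auto
  have "prob ?E = prob ?H * pmf (K (h ! t)) y"
  proof (cases "0 < prob ?H")
    case pos: True
    then have "cond_prob M (\<lambda>\<omega>. X (Suc t) \<omega> = y) (\<lambda>\<omega>. \<forall>s\<le>t. X s \<omega> = h ! s) = pmf (K (h ! t)) y"
      using chain unfolding markov_chain_def by blast
    then show ?thesis using pos unfolding cond_prob_def by (simp add: field_simps)
  next
    case False
    then have 0: "prob ?H = 0" using measure_nonneg[of M ?H] by simp
    have "prob ?E \<le> prob ?H" by (intro finite_measure_mono) auto
    then show ?thesis using 0 measure_nonneg[of M ?E] by simp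
  qed
  moreover have "{\<omega> \<in> space M. (history t \<omega>, X (Suc t) \<omega>) = (h, y)} = ?E"
    "{\<omega> \<in> space M. history t \<omega> = h} = ?H"
    using True by (auto simp: history_eq_iff)
  ultimately show ?thesis
    by (simp add: last emeasure_eq_measure ennreal_mult)
next
  case False
  then show ?thesis by (simp add: history_eq_iff)
qed

text \<open>
  The Markov property in the only form that is used below: sum over the countably many values of the
  history and the next state.
\<close>
lemma nn_integral_step:
  fixes a :: "(nat \<Rightarrow> 's) \<Rightarrow> ennreal"
  assumes "determined_by t a"
  shows "(\<integral>\<^sup>+\<omega>. a (path \<omega>) * g (X t \<omega>) (X (Suc t) \<omega>) \<partial>M) =
    (\<integral>\<^sup>+\<omega>. a (path \<omega>) * (\<integral>\<^sup>+y. g (X t \<omega>) y \<partial>K (X t \<omega>)) \<partial>M)"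
proof -
  let ?p = "\<lambda>h. emeasure M {\<omega> \<in> space M. history t \<omega> = h}"
  let ?F = "\<lambda>(h, y). a (nth h) * g (last h) y"
  have Y: "(\<lambda>\<omega>. (history t \<omega>, X (Suc t) \<omega>)) \<in> M \<rightarrow>\<^sub>M count_space UNIV"
    by (rule measurable_compose_countable[OF _ history_measurable]) measurable
  have "(\<integral>\<^sup>+\<omega>. a (path \<omega>) * g (X t \<omega>) (X (Suc t) \<omega>) \<partial>M) =
      (\<integral>\<^sup>+\<omega>. ?F (history t \<omega>, X (Suc t) \<omega>) \<partial>M)"
    by (simp add: determined_history[OF assms] last_history)
  also have "\<dots> = (\<integral>\<^sup>+z. emeasure M {\<omega> \<in> space M. (history t \<omega>, X (Suc t) \<omega>) = z} * ?F z
      \<partial>count_space UNIV)"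
    by (rule nn_integral_countable_valued[OF Y])
  also have "\<dots> = (\<integral>\<^sup>+h. \<integral>\<^sup>+y. ?p h * ennreal (pmf (K (last h)) y) * (a (nth h) * g (last h) y)
      \<partial>count_space UNIV \<partial>count_space UNIV)"
    by (subst nn_integral_fst_count_space[symmetric]) (simp only: emeasure_history_step case_prod_conv)
  also have "\<dots> = (\<integral>\<^sup>+h. ?p h * (a (nth h) * (\<integral>\<^sup>+y. g (last h) y \<partial>K (last h))) \<partial>count_space UNIV)"
    by (simp add: nn_integral_measure_pmf nn_integral_cmult[symmetric] mult_ac)
  also have "\<dots> = (\<integral>\<^sup>+\<omega>. a (nth (history t \<omega>)) *
      (\<integral>\<^sup>+y. g (last (history t \<omega>)) y \<partial>K (last (history t \<omega>))) \<partial>M)"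
    by (rule nn_integral_countable_valued[symmetric, OF history_measurable])
  finally show ?thesis
    by (simp add: determined_history[OF assms] last_history)
qed

lemma AE_step_in_set_pmf: "AE \<omega> in M. X (Suc t) \<omega> \<in> set_pmf (K (X t \<omega>))"
proof -
  have "(\<integral>\<^sup>+\<omega>. 1 * indicator (- set_pmf (K (X t \<omega>))) (X (Suc t) \<omega>) \<partial>M) =
      (\<integral>\<^sup>+\<omega>. 1 * (\<integral>\<^sup>+y. indicator (- set_pmf (K (X t \<omega>))) y \<partial>K (X t \<omega>)) \<partial>M)"
    by (rule nn_integral_step[where a = "\<lambda>_. 1"]) (simp add: determined_by_def)
  also have "\<dots> = 0"
  proof -
    have "(\<integral>\<^sup>+y. indicator (- set_pmf (K l)) y \<partial>K l) = (0 :: ennreal)" for l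
      by (subst nn_integral_0_iff_AE) (auto simp: AE_measure_pmf_iff indicator_def)
    then show ?thesis by simp
  qed
  finally have 0: "(\<integral>\<^sup>+\<omega>. indicator (- set_pmf (K (X t \<omega>))) (X (Suc t) \<omega>) \<partial>M) = 0" by simp
  have "(\<lambda>\<omega>. indicator (- set_pmf (K (X t \<omega>))) (X (Suc t) \<omega>) :: ennreal) \<in> borel_measurable M"
    by (rule measurable_compose_countable[OF _ X_measurable[of t]]) measurable
  from iffD1[OF nn_integral_0_iff_AE[OF this] 0] show ?thesis
    by eventually_elim (auto simp: indicator_def split: if_splits)
qed

text \<open>
  The condition on the state at time \<open>s + 1\<close> is absorbed into \<open>a\<close>, so that the induction
  hypothesis applies from time \<open>s + 1\<close> on.
\<close>
lemma nn_integral_avoid: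
  fixes a :: "(nat \<Rightarrow> 's) \<Rightarrow> ennreal"
  assumes "determined_by s a"
  shows "(\<integral>\<^sup>+\<omega>. a (path \<omega>) * of_bool (\<forall>i\<in>{1..m}. X (s + i) \<omega> \<notin> Z) \<partial>M) =
    (\<integral>\<^sup>+\<omega>. a (path \<omega>) * avoid K Z m (X s \<omega>) \<partial>M)"
  using assms
proof (induction m arbitrary: s a)
  case 0
  then show ?case by simp
next
  case (Suc m)
  define a' where "a' x = a x * indicator (- Z) (x (Suc s))" for x :: "nat \<Rightarrow> 's"
  have a': "determined_by (Suc s) a'"
    using Suc.prems unfolding determined_by_def a'_def by (metis le_SucI order_refl)
  have split: "(\<forall>i\<in>{1..Suc m}. X (s + i) \<omega> \<notin> Z) \<longleftrightarrow>
      X (Suc s) \<omega> \<notin> Z \<and> (\<forall>i\<in>{1..m}. X (Suc s + i) \<omega> \<notin> Z)" for \<omega>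
  proof -
    have "(\<forall>i\<in>{1..Suc m}. P i) \<longleftrightarrow> P 1 \<and> (\<forall>i\<in>{1..m}. P (Suc i))" for P :: "nat \<Rightarrow> bool"
    proof (intro iffI ballI)
      fix i assume P: "P 1 \<and> (\<forall>i\<in>{1..m}. P (Suc i))" and i: "i \<in> {1..Suc m}"
      then obtain j where "i = Suc j" by (cases i) auto
      then show "P i" using P i by (cases "j = 0") auto
    qed auto
    from this[of "\<lambda>i. X (s + i) \<omega> \<notin> Z"] show ?thesis by simp
  qed
  have "(\<integral>\<^sup>+\<omega>. a (path \<omega>) * of_bool (\<forall>i\<in>{1..Suc m}. X (s + i) \<omega> \<notin> Z) \<partial>M) =
      (\<integral>\<^sup>+\<omega>. a' (path \<omega>) * of_bool (\<forall>i\<in>{1..m}. X (Suc s + i) \<omega> \<notin> Z) \<partial>M)"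
    unfolding split a'_def by (intro nn_integral_cong) (auto simp: indicator_def)
  also have "\<dots> = (\<integral>\<^sup>+\<omega>. a' (path \<omega>) * avoid K Z m (X (Suc s) \<omega>) \<partial>M)"
    by (rule Suc.IH[OF a'])
  also have "\<dots> = (\<integral>\<^sup>+\<omega>. a (path \<omega>) * (indicator (- Z) (X (Suc s) \<omega>) * avoid K Z m (X (Suc s) \<omega>)) \<partial>M)"
    by (simp add: a'_def mult.assoc)
  also have "\<dots> = (\<integral>\<^sup>+\<omega>. a (path \<omega>) * avoid K Z (Suc m) (X s \<omega>) \<partial>M)"
    using nn_integral_step[OF Suc.prems, of "\<lambda>_ y. indicator (- Z) y * avoid K Z m y"] by simp
  finally show ?case .
qed

lemma AE_hits:
  assumes lim: "\<And>l. l \<in> S \<Longrightarrow> (\<lambda>m. avoid K Z m l) \<longlonglongrightarrow> 0"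
  shows "AE \<omega> in M. \<exists>t. X t \<omega> \<in> Z"
proof -
  let ?N = "{\<omega> \<in> space M. \<forall>t. X t \<omega> \<notin> Z}"
  have meas: "(\<lambda>\<omega>. avoid K Z m (X 0 \<omega>)) \<in> borel_measurable M" for m
    by (rule measurable_compose[OF X_measurable]) simp
  have "(\<lambda>m. \<integral>\<^sup>+\<omega>. avoid K Z m (X 0 \<omega>) \<partial>M) \<longlonglongrightarrow> (\<integral>\<^sup>+\<omega>. 0 \<partial>M)"
    by (rule nn_integral_dominated_convergence[where w = "\<lambda>_. 1"])
      (auto intro: meas avoid_le_1 lim X_in simp: emeasure_space_1)
  moreover have "emeasure M ?N \<le> (\<integral>\<^sup>+\<omega>. avoid K Z m (X 0 \<omega>) \<partial>M)" for m
  proof -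
    have "emeasure M ?N = (\<integral>\<^sup>+\<omega>. indicator ?N \<omega> \<partial>M)" by simp
    also have "\<dots> \<le> (\<integral>\<^sup>+\<omega>. 1 * of_bool (\<forall>i\<in>{1..m}. X (0 + i) \<omega> \<notin> Z) \<partial>M)"
      by (intro nn_integral_mono) (auto simp: indicator_def)
    also have "\<dots> = (\<integral>\<^sup>+\<omega>. 1 * avoid K Z m (X 0 \<omega>) \<partial>M)"
      by (rule nn_integral_avoid[where a = "\<lambda>_. 1"]) (simp add: determined_by_def)
    finally show ?thesis by simp
  qed
  ultimately have "emeasure M ?N \<le> 0"
    by (intro LIMSEQ_le_const[of "\<lambda>m. \<integral>\<^sup>+\<omega>. avoid K Z m (X 0 \<omega>) \<partial>M"]) auto
  then show ?thesis
    by (intro AE_I[of _ _ ?N]) auto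
qed

text \<open>
  Decomposition at the last visit: \<open>s \<le> t\<close> is the last visit up to time \<open>t\<close> with
  probability at least \<open>T t\<close> times the probability of a visit at \<open>s\<close>, and these events are
  disjoint.
\<close>
lemma expected_visits_times_tail_le_1:
  fixes T :: "nat \<Rightarrow> real"
  assumes T: "\<And>z m. z \<in> Z \<Longrightarrow> avoid K Z m z = ennreal (T m)" and T0: "\<And>m. 0 \<le> T m"
  shows "(\<Sum>s\<le>t. prob {\<omega> \<in> space M. X s \<omega> \<in> Z}) * T t \<le> 1"
proof -
  let ?P = "\<lambda>s. {\<omega> \<in> space M. X s \<omega> \<in> Z}"
  let ?e = "\<lambda>s \<omega>. of_bool (X s \<omega> \<in> Z) * of_bool (\<forall>i\<in>{1..t - s}. X (s + i) \<omega> \<notin> Z) :: ennreal"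
  have "ennreal (\<Sum>s\<le>t. prob (?P s) * T t) = (\<Sum>s\<le>t. ennreal (prob (?P s)) * ennreal (T t))"
    using T0 by (simp add: sum_ennreal[symmetric] ennreal_mult)
  also have "\<dots> \<le> (\<Sum>s\<le>t. \<integral>\<^sup>+\<omega>. ?e s \<omega> \<partial>M)"
  proof (intro sum_mono)
    fix s assume "s \<in> {..t}"
    have "ennreal (prob (?P s)) * ennreal (T t) = (\<integral>\<^sup>+\<omega>. ennreal (T t) * indicator (?P s) \<omega> \<partial>M)"
      by (subst nn_integral_cmult_indicator) (auto simp: emeasure_eq_measure mult.commute)
    also have "\<dots> \<le> (\<integral>\<^sup>+\<omega>. of_bool (X s \<omega> \<in> Z) * avoid K Z (t - s) (X s \<omega>) \<partial>M)"
    proof (intro nn_integral_mono)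
      fix \<omega>
      show "ennreal (T t) * indicator (?P s) \<omega> \<le> of_bool (X s \<omega> \<in> Z) * avoid K Z (t - s) (X s \<omega>)"
        using T[of "X s \<omega>" t] avoid_antimono[of "t - s" t K Z "X s \<omega>"]
        by (cases "X s \<omega> \<in> Z") (auto simp: indicator_def)
    qed
    also have "\<dots> = (\<integral>\<^sup>+\<omega>. ?e s \<omega> \<partial>M)"
      by (rule nn_integral_avoid[symmetric, where a = "\<lambda>x. of_bool (x s \<in> Z)"])
        (auto simp: determined_by_def)
    finally show "ennreal (prob (?P s)) * ennreal (T t) \<le> (\<integral>\<^sup>+\<omega>. ?e s \<omega> \<partial>M)" .
  qed
  also have "\<dots> = (\<integral>\<^sup>+\<omega>. (\<Sum>s\<le>t. ?e s \<omega>) \<partial>M)"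
    by (rule nn_integral_sum[symmetric]) measurable
  also have "\<dots> \<le> (\<integral>\<^sup>+\<omega>. 1 \<partial>M)"
  proof (intro nn_integral_mono)
    fix \<omega>
    let ?L = "{s \<in> {..t}. X s \<omega> \<in> Z \<and> (\<forall>i\<in>{1..t - s}. X (s + i) \<omega> \<notin> Z)}"
    have no: False if "s \<in> ?L" "s' \<in> ?L" "s < s'" for s s'
    proof -
      from that have "s' - s \<in> {1..t - s}" "X (s + (s' - s)) \<omega> \<in> Z" by auto
      with that(1) show False by blast
    qed
    have card_L: "card ?L \<le> Suc 0"
    proof (subst card_le_Suc0_iff_eq)
      show "\<forall>s\<in>?L. \<forall>s'\<in>?L. s = s'"
      proof (intro ballI)
        fix s s' assume "s \<in> ?L" "s' \<in> ?L"
        then show "s = s'" using no[of s s'] no[of s' s] by (cases s s' rule: linorder_cases) blast+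
      qed
    qed simp
    moreover have "(\<Sum>s\<le>t. ?e s \<omega>) = of_nat (card ?L)"
    proof -
      have "of_nat (card ?L) = (\<Sum>s\<in>?L. 1 :: ennreal)" by simp
      also have "\<dots> = (\<Sum>s\<le>t. if X s \<omega> \<in> Z \<and> (\<forall>i\<in>{1..t - s}. X (s + i) \<omega> \<notin> Z) then 1 else 0)"
        by (rule sum.inter_filter) simp
      also have "\<dots> = (\<Sum>s\<le>t. ?e s \<omega>)"
        by (rule sum.cong) (simp_all add: of_bool_def)
      finally show ?thesis ..
    qed
    ultimately show "(\<Sum>s\<le>t. ?e s \<omega>) \<le> 1"
      using of_nat_mono[OF card_L, where 'a = ennreal] by (simp only: of_nat_Suc of_nat_0 add_0_right)
  qed
  also have "\<dots> = 1" by (simp add: emeasure_space_1)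
  finally show ?thesis
    by (simp add: sum_distrib_right ennreal_le_1)
qed

text \<open>
  By the Markov property the series has expectation at most \<open>c\<close> times the given convergent
  series.
\<close>
lemma AE_weighted_sum_finite:
  assumes g: "\<And>l. l \<in> S \<Longrightarrow> (\<integral>\<^sup>+y. g l y \<partial>K l) \<le> c * indicator Y l" and c: "c < \<infinity>"
    and w: "\<And>s. 0 \<le> w s" and summ: "summable (\<lambda>s. w s * prob {\<omega> \<in> space M. X s \<omega> \<in> Y})"
  shows "AE \<omega> in M. (\<Sum>s. ennreal (w s) * g (X s \<omega>) (X (Suc s) \<omega>)) \<noteq> \<infinity>"
proof -
  let ?P = "\<lambda>s. {\<omega> \<in> space M. X s \<omega> \<in> Y}"
  have [measurable]: "(\<lambda>\<omega>. g (X s \<omega>) (X (Suc s) \<omega>)) \<in> borel_measurable M" for s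
    by (rule measurable_compose_countable[OF measurable_compose[OF X_measurable] X_measurable]) simp
  have "(\<integral>\<^sup>+\<omega>. (\<Sum>s. ennreal (w s) * g (X s \<omega>) (X (Suc s) \<omega>)) \<partial>M) =
      (\<Sum>s. \<integral>\<^sup>+\<omega>. ennreal (w s) * g (X s \<omega>) (X (Suc s) \<omega>) \<partial>M)"
    by (rule nn_integral_suminf) measurable
  also have "\<dots> \<le> (\<Sum>s. c * ennreal (w s * prob (?P s)))"
  proof (intro suminf_le summableI)
    fix s
    have "(\<integral>\<^sup>+\<omega>. ennreal (w s) * g (X s \<omega>) (X (Suc s) \<omega>) \<partial>M) =
        (\<integral>\<^sup>+\<omega>. ennreal (w s) * (\<integral>\<^sup>+y. g (X s \<omega>) y \<partial>K (X s \<omega>)) \<partial>M)"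
      by (rule nn_integral_step[where a = "\<lambda>_. ennreal (w s)"]) (simp add: determined_by_def)
    also have "\<dots> \<le> (\<integral>\<^sup>+\<omega>. ennreal (w s) * c * indicator (?P s) \<omega> \<partial>M)"
    proof (rule nn_integral_mono)
      fix \<omega> assume "\<omega> \<in> space M"
      then have "(\<integral>\<^sup>+y. g (X s \<omega>) y \<partial>K (X s \<omega>)) \<le> c * indicator (?P s) \<omega>"
        using g[OF X_in[of \<omega> s]] by (simp add: indicator_def)
      then show "ennreal (w s) * (\<integral>\<^sup>+y. g (X s \<omega>) y \<partial>K (X s \<omega>)) \<le> ennreal (w s) * c * indicator (?P s) \<omega>"
        unfolding mult.assoc by (rule mult_left_mono) simp
    qed
    also have "\<dots> = ennreal (w s) * c * emeasure M (?P s)"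
      by (rule nn_integral_cmult_indicator) measurable
    also have "\<dots> = c * ennreal (w s * prob (?P s))"
      by (simp add: emeasure_eq_measure ennreal_mult[OF w] mult_ac)
    finally show "(\<integral>\<^sup>+\<omega>. ennreal (w s) * g (X s \<omega>) (X (Suc s) \<omega>) \<partial>M) \<le> c * ennreal (w s * prob (?P s))" .
  qed
  also have "\<dots> = c * ennreal (\<Sum>s. w s * prob (?P s))"
    using w by (simp add: ennreal_suminf_cmult suminf_ennreal2 summ)
  also have "\<dots> < \<infinity>" using c by (simp add: ennreal_mult_less_top)
  finally show ?thesis
    by (intro nn_integral_PInf_AE) auto
qed

text \<open>
  Every time \<open>r < t\<close> after the first visit has a last visit \<open>s \<le> r\<close>, so at least
  \<open>t - \<sigma>\<close> pairs \<open>(s, m)\<close> with \<open>s, m < t\<close> consist of a visit at \<open>s\<close> and \<open>m\<close>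
  further steps off \<open>Z\<close>. Give such a pair the weight \<open>a s * w m\<close>, where \<open>a s\<close> decays in
  the number of visits and \<open>w m = real (Suc m) powr (\<gamma>' - 1)\<close>. The total weight over all pairs
  has expectation at most the product of the series of \<open>k powr - \<kappa>\<close> and of \<open>w m * T m\<close>, both
  convergent when \<open>\<kappa> > 1\<close> and \<open>\<gamma>' < \<gamma>\<close>. Hence it is almost surely finite, and
  comparing it with the weight of the pairs before \<open>t\<close> bounds the number of visits from below.
\<close>
lemma AE_visits_ge_powr:
  fixes T :: "nat \<Rightarrow> real"
  assumes T: "\<And>z m. z \<in> Z \<Longrightarrow> avoid K Z m z = ennreal (T m)" and T0: "\<And>m. 0 \<le> T m"
    and tail: "\<And>b. b < \<gamma> \<Longrightarrow> \<forall>\<^sub>F n in sequentially. T n \<le> real n powr - b"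
    and hits: "AE \<omega> in M. \<exists>t. X t \<omega> \<in> Z"
    and \<rho>: "0 < \<rho>" "\<rho> < \<gamma>" and \<gamma>: "\<gamma> \<le> 1"
  shows "AE \<omega> in M. \<forall>\<^sub>F t in sequentially. real t powr \<rho> \<le> real (visits Z t (path \<omega>))"
proof -
  define \<gamma>' where "\<gamma>' = (\<rho> + \<gamma>) / 2"
  define \<kappa> where "\<kappa> = (1 + \<gamma>' / \<rho>) / 2"
  have \<gamma>': "\<rho> < \<gamma>'" "\<gamma>' < \<gamma>" using \<rho> by (auto simp: \<gamma>'_def)
  have \<kappa>: "1 < \<kappa>" using \<rho> \<gamma>' by (simp add: \<kappa>_def field_simps)
  define a where "a s x = (if x s \<in> Z then real (visits Z (Suc s) x) powr - \<kappa> else 0)"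
    for s and x :: "nat \<Rightarrow> 's"
  define w where "w m = real (Suc m) powr (\<gamma>' - 1)" for m
  define e where "e s m \<omega> = (of_bool (\<forall>i\<in>{1..m}. X (s + i) \<omega> \<notin> Z) :: real)" for s m \<omega>
  have a0: "0 \<le> a s x" and w0: "0 \<le> w m" and e0: "0 \<le> e s m \<omega>" for s x m \<omega>
    by (simp_all add: a_def w_def e_def)
  have det: "determined_by s (\<lambda>x. ennreal (a s x))" for s
  proof -
    have "visits Z (Suc s) x = visits Z (Suc s) y" if "\<forall>i\<le>s. x i = y i" for x y
      using that by (intro visits_cong) auto
    then show ?thesis unfolding determined_by_def a_def by (metis order_refl)
  qed
  have [measurable]: "(\<lambda>\<omega>. ennreal (a s (path \<omega>))) \<in> borel_measurable M" for s
    by (rule determined_borel_measurable[OF det])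
  have e_meas [measurable]: "(\<lambda>\<omega>. ennreal (e s m \<omega>)) \<in> borel_measurable M" for s m
    unfolding e_def by measurable
  define c where "c = (\<Sum>k. real (Suc k) powr (- 1 - (\<kappa> - 1)))"
  have sum_a: "(\<Sum>s. ennreal (a s x)) \<le> ennreal c" for x
    unfolding suminf_eq_SUP
  proof (rule SUP_least)
    fix n
    have "(\<Sum>s<n. a s x) = (\<Sum>k=1..visits Z n x. real k powr - \<kappa>)"
      unfolding a_def by (rule sum_over_visits)
    also have "\<dots> = (\<Sum>k<visits Z n x. real (Suc k) powr (- 1 - (\<kappa> - 1)))"
      by (simp add: sum.atLeast1_atMost_eq)
    also have "\<dots> \<le> c"
      unfolding c_def using summable_Suc_powr[of "\<kappa> - 1"] \<kappa> by (intro sum_le_suminf) auto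
    finally show "(\<Sum>s<n. ennreal (a s x)) \<le> ennreal c"
      using a0 by (simp add: sum_ennreal ennreal_leI)
  qed
  have summ_wT: "summable (\<lambda>m. w m * T m)"
    unfolding w_def using tail[of "(\<gamma>' + \<gamma>) / 2"] T0 \<gamma>'
    by (intro summable_powr_times_tail[where b = "(\<gamma>' + \<gamma>) / 2"]) auto
  let ?F = "\<lambda>\<omega>. \<Sum>m. ennreal (w m) * (\<Sum>s. ennreal (a s (path \<omega>)) * ennreal (e s m \<omega>))"
  have "(\<integral>\<^sup>+\<omega>. ?F \<omega> \<partial>M) =
      (\<Sum>m. ennreal (w m) * (\<Sum>s. \<integral>\<^sup>+\<omega>. ennreal (a s (path \<omega>)) * ennreal (e s m \<omega>) \<partial>M))"
    by (simp add: nn_integral_suminf nn_integral_cmult)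
  also have "\<dots> \<le> (\<Sum>m. ennreal (w m) * (ennreal c * ennreal (T m)))"
  proof (intro suminf_le summableI mult_left_mono zero_le)
    fix m
    have "(\<integral>\<^sup>+\<omega>. ennreal (a s (path \<omega>)) * ennreal (e s m \<omega>) \<partial>M) =
        (\<integral>\<^sup>+\<omega>. ennreal (a s (path \<omega>)) \<partial>M) * ennreal (T m)" for s
    proof -
      have "(\<integral>\<^sup>+\<omega>. ennreal (a s (path \<omega>)) * ennreal (e s m \<omega>) \<partial>M) =
          (\<integral>\<^sup>+\<omega>. ennreal (a s (path \<omega>)) * of_bool (\<forall>i\<in>{1..m}. X (s + i) \<omega> \<notin> Z) \<partial>M)"
        by (intro nn_integral_cong) (simp add: e_def)
      also have "\<dots> = (\<integral>\<^sup>+\<omega>. ennreal (a s (path \<omega>)) * avoid K Z m (X s \<omega>) \<partial>M)"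
        by (rule nn_integral_avoid[OF det])
      also have "\<dots> = (\<integral>\<^sup>+\<omega>. ennreal (a s (path \<omega>)) * ennreal (T m) \<partial>M)"
        by (intro nn_integral_cong) (simp add: a_def T)
      also have "\<dots> = (\<integral>\<^sup>+\<omega>. ennreal (a s (path \<omega>)) \<partial>M) * ennreal (T m)"
        by (rule nn_integral_multc) measurable
      finally show ?thesis .
    qed
    then have "(\<Sum>s. \<integral>\<^sup>+\<omega>. ennreal (a s (path \<omega>)) * ennreal (e s m \<omega>) \<partial>M) =
        (\<integral>\<^sup>+\<omega>. (\<Sum>s. ennreal (a s (path \<omega>))) \<partial>M) * ennreal (T m)"
      by (simp add: nn_integral_suminf)
    also have "\<dots> \<le> (\<integral>\<^sup>+\<omega>. ennreal c \<partial>M) * ennreal (T m)"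
      by (intro mult_right_mono nn_integral_mono sum_a) auto
    also have "\<dots> = ennreal c * ennreal (T m)" by (simp add: emeasure_space_1)
    finally show "(\<Sum>s. \<integral>\<^sup>+\<omega>. ennreal (a s (path \<omega>)) * ennreal (e s m \<omega>) \<partial>M) \<le> ennreal c * ennreal (T m)" .
  qed
  also have "\<dots> = ennreal c * (\<Sum>m. ennreal (w m * T m))"
    using w0 T0 by (subst ennreal_suminf_cmult[symmetric]) (simp add: ennreal_mult mult_ac)
  also have "\<dots> = ennreal c * ennreal (\<Sum>m. w m * T m)"
    using w0 T0 summ_wT by (subst suminf_ennreal2) auto
  also have "\<dots> < \<infinity>" by (simp add: ennreal_mult_less_top)
  finally have "AE \<omega> in M. ?F \<omega> \<noteq> \<infinity>"
    by (intro nn_integral_PInf_AE) auto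
  with hits show ?thesis
  proof eventually_elim
    case (elim \<omega>)
    obtain \<sigma> where \<sigma>: "X \<sigma> \<omega> \<in> Z" using elim(1) by blast
    define z where "z = enn2real (?F \<omega>)"
    have z: "?F \<omega> = ennreal z" using elim(2) by (simp add: z_def ennreal_enn2real less_top)
    have z0: "0 \<le> z" by (simp add: z_def)
    let ?N = "\<lambda>t. visits Z t (path \<omega>)"
    have bound: "(real t - real \<sigma>) * (real t powr (\<gamma>' - 1) * real (?N t) powr - \<kappa>) \<le> z" if t: "\<sigma> < t" for t
    proof -
      define P where "P = {(s, m). s < t \<and> m < t \<and> X s \<omega> \<in> Z \<and> (\<forall>i\<in>{1..m}. X (s + i) \<omega> \<notin> Z)}"
      have P_sub: "P \<subseteq> {..<t} \<times> {..<t}" by (auto simp: P_def)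
      define \<tau> where "\<tau> r = Max {s. s \<le> r \<and> X s \<omega> \<in> Z}" for r
      have \<tau>: "\<tau> r \<le> r" "X (\<tau> r) \<omega> \<in> Z" "\<And>s. s \<le> r \<Longrightarrow> X s \<omega> \<in> Z \<Longrightarrow> s \<le> \<tau> r" if "\<sigma> \<le> r" for r
      proof -
        have fin: "finite {s. s \<le> r \<and> X s \<omega> \<in> Z}" by simp
        have "\<tau> r \<in> {s. s \<le> r \<and> X s \<omega> \<in> Z}"
          unfolding \<tau>_def using that \<sigma> by (intro Max_in fin) auto
        then show "\<tau> r \<le> r" "X (\<tau> r) \<omega> \<in> Z" by auto
        show "s \<le> \<tau> r" if "s \<le> r" "X s \<omega> \<in> Z" for s
          unfolding \<tau>_def using that by (intro Max_ge fin) auto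
      qed
      have "card {\<sigma>..<t} \<le> card P"
      proof (rule card_inj_on_le[where f = "\<lambda>r. (\<tau> r, r - \<tau> r)"])
        show "inj_on (\<lambda>r. (\<tau> r, r - \<tau> r)) {\<sigma>..<t}"
        proof (rule inj_onI)
          fix r r' assume "r \<in> {\<sigma>..<t}" "r' \<in> {\<sigma>..<t}" "(\<tau> r, r - \<tau> r) = (\<tau> r', r' - \<tau> r')"
          then show "r = r'" using \<tau>(1)[of r] \<tau>(1)[of r'] by auto
        qed
        show "(\<lambda>r. (\<tau> r, r - \<tau> r)) ` {\<sigma>..<t} \<subseteq> P"
        proof safe
          fix r assume r: "r \<in> {\<sigma>..<t}"
          have "X (\<tau> r + i) \<omega> \<notin> Z" if "i \<in> {1..r - \<tau> r}" for i
          proof -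
            have "\<tau> r + i \<le> r" using \<tau>(1)[of r] that r by auto
            then show ?thesis using \<tau>(3)[of r "\<tau> r + i"] that r by auto
          qed
          then show "(\<tau> r, r - \<tau> r) \<in> P"
            using \<tau>(1,2)[of r] r by (auto simp: P_def)
        qed
        show "finite P" using P_sub finite_subset by blast
      qed
      then have card: "real t - real \<sigma> \<le> real (card P)" using t by simp
      have "(real t - real \<sigma>) * (real t powr (\<gamma>' - 1) * real (?N t) powr - \<kappa>)
          \<le> real (card P) * (real t powr (\<gamma>' - 1) * real (?N t) powr - \<kappa>)"
        using card by (intro mult_right_mono) auto
      also have "\<dots> = (\<Sum>(s, m)\<in>P. real t powr (\<gamma>' - 1) * real (?N t) powr - \<kappa>)" by simp
      also have "\<dots> \<le> (\<Sum>(s, m)\<in>P. w m * (a s (path \<omega>) * e s m \<omega>))"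
      proof (intro sum_mono, clarify)
        fix s m assume "(s, m) \<in> P"
        then have sm: "s < t" "m < t" "X s \<omega> \<in> Z" "e s m \<omega> = 1" by (auto simp: P_def e_def)
        have "real t powr (\<gamma>' - 1) \<le> w m"
          unfolding w_def using sm \<gamma>' \<gamma> by (intro powr_mono2') auto
        moreover have "real (?N t) powr - \<kappa> \<le> a s (path \<omega>)"
          using sm \<kappa> visits_mono[of "Suc s" t Z "path \<omega>"]
          unfolding a_def by (auto simp: visits_Suc intro!: powr_mono2')
        ultimately show "real t powr (\<gamma>' - 1) * real (?N t) powr - \<kappa> \<le> w m * (a s (path \<omega>) * e s m \<omega>)"
          using sm w0 by (auto intro!: mult_mono)
      qed
      also have "\<dots> \<le> (\<Sum>(s, m)\<in>{..<t} \<times> {..<t}. w m * (a s (path \<omega>) * e s m \<omega>))"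
        using P_sub w0 a0 e0 by (intro sum_mono2) auto
      also have "\<dots> = (\<Sum>m<t. w m * (\<Sum>s<t. a s (path \<omega>) * e s m \<omega>))"
        by (simp add: sum.cartesian_product[symmetric] sum_distrib_left) (rule sum.swap)
      finally have 1: "(real t - real \<sigma>) * (real t powr (\<gamma>' - 1) * real (?N t) powr - \<kappa>)
        \<le> (\<Sum>m<t. w m * (\<Sum>s<t. a s (path \<omega>) * e s m \<omega>))" .
      have "ennreal (\<Sum>m<t. w m * (\<Sum>s<t. a s (path \<omega>) * e s m \<omega>)) =
          (\<Sum>m<t. ennreal (w m) * (\<Sum>s<t. ennreal (a s (path \<omega>)) * ennreal (e s m \<omega>)))"
        using w0 a0 e0 by (simp add: sum_ennreal[symmetric] ennreal_mult sum_nonneg)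
      also have "\<dots> \<le> (\<Sum>m<t. ennreal (w m) * (\<Sum>s. ennreal (a s (path \<omega>)) * ennreal (e s m \<omega>)))"
        by (intro sum_mono mult_left_mono sum_le_suminf) auto
      also have "\<dots> \<le> ?F \<omega>" by (intro sum_le_suminf) auto
      also have "\<dots> = ennreal z" by (rule z)
      finally show ?thesis using 1 z0 by (simp add: ennreal_le_iff)
    qed
    (* By the choice of \<kappa>, fewer than t powr \<rho> visits would make the left side of the bound
       at least half of t powr ((\<gamma>' - \<rho>) / 2). *)
    have "filterlim (\<lambda>t. real t powr ((\<gamma>' - \<rho>) / 2)) at_top sequentially"
      using \<gamma>' by real_asymp
    then have "\<forall>\<^sub>F t in sequentially. 2 * z < real t powr ((\<gamma>' - \<rho>) / 2)"
      by (simp add: filterlim_at_top_dense)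
    then show ?case
      using eventually_gt_at_top[of "2 * \<sigma>"]
    proof eventually_elim
      case (elim t)
      show ?case
      proof (rule ccontr)
        assume "\<not> real t powr \<rho> \<le> real (?N t)"
        then have lt: "real (?N t) < real t powr \<rho>" by simp
        have "\<sigma> < t" "0 < t" using elim by auto
        then have "{s. s < t \<and> X s \<omega> \<in> Z} \<noteq> {}" using \<sigma> by blast
        then have "0 < ?N t" unfolding visits_def by (subst card_gt_0_iff) simp
        then have "(real t powr \<rho>) powr - \<kappa> \<le> real (?N t) powr - \<kappa>"
          using lt \<kappa> by (intro powr_mono2') auto
        then have N: "real t powr (- \<rho> * \<kappa>) \<le> real (?N t) powr - \<kappa>" by (simp add: powr_powr)
        have exponent: "1 + (\<gamma>' - 1 + - \<rho> * \<kappa>) = (\<gamma>' - \<rho>) / 2"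
          using \<rho> by (simp add: \<kappa>_def field_simps)
        have "real t powr ((\<gamma>' - \<rho>) / 2) = real t * (real t powr (\<gamma>' - 1) * real t powr (- \<rho> * \<kappa>))"
          using \<open>0 < t\<close> by (simp only: exponent[symmetric] powr_add) simp
        also have "\<dots> \<le> (2 * (real t - real \<sigma>)) * (real t powr (\<gamma>' - 1) * real (?N t) powr - \<kappa>)"
          using elim N by (intro mult_mono mult_left_mono) auto
        also have "\<dots> \<le> 2 * z" using bound[OF \<open>\<sigma> < t\<close>] by (simp only: mult.assoc)
        finally show False using elim by simp
      qed
    qed
  qed
qed

lemma visits_measurable [measurable]:
  "(\<lambda>\<omega>. visits Z t (path \<omega>)) \<in> M \<rightarrow>\<^sub>M count_space UNIV"
  by (rule determined_measurable[of t]) (auto simp: determined_by_def intro!: visits_cong)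

lemma transition_measurable:
  "Measurable.pred M (\<lambda>\<omega>. P (X s \<omega>) (X (Suc s) \<omega>))"
  by (rule measurable_compose_countable[OF measurable_compose[OF X_measurable] X_measurable]) simp

text \<open>
  On the event that no jump from \<open>Z\<close> has exceeded \<open>x\<close>, and zero elsewhere, the exponential of
  \<open>p\<close> times the number of visits is a supermartingale, because each visit multiplies it in mean
  by at most \<open>exp p * (1 - p) \<le> 1\<close>. On the event in question it is at least \<open>exp (p * n)\<close>.
\<close>
lemma prob_no_large_jump:
  assumes p: "\<And>z. z \<in> Z \<Longrightarrow> p \<le> measure_pmf.prob (K z) {y. x < J z y}" and p0: "0 \<le> p"
  shows "prob {\<omega> \<in> space M. n \<le> real (visits Z t (path \<omega>)) \<and>
      (\<forall>s<t. X s \<omega> \<in> Z \<longrightarrow> \<not> x < J (X s \<omega>) (X (Suc s) \<omega>))} \<le> exp (- (p * n))"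
proof -
  define Y where "Y t u = (if \<forall>s<t. u s \<in> Z \<longrightarrow> \<not> x < J (u s) (u (Suc s))
      then ennreal (exp (p * real (visits Z t u))) else 0)" for t and u :: "nat \<Rightarrow> 's"
  define g where "g l y = (if l \<in> Z then ennreal (exp p) * indicator {y. \<not> x < J l y} y else 1)" for l y
  have det: "determined_by t (Y t)" for t
  proof -
    have "Y t u = Y t v" if eq: "\<forall>i\<le>t. u i = v i" for u v
    proof -
      have "visits Z t u = visits Z t v" using eq by (intro visits_cong) auto
      moreover have "(\<forall>s<t. u s \<in> Z \<longrightarrow> \<not> x < J (u s) (u (Suc s))) \<longleftrightarrow>
          (\<forall>s<t. v s \<in> Z \<longrightarrow> \<not> x < J (v s) (v (Suc s)))"
        using eq by (metis Suc_leI less_imp_le_nat)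
      ultimately show ?thesis by (simp add: Y_def)
    qed
    then show ?thesis by (simp add: determined_by_def)
  qed
  have g_le: "(\<integral>\<^sup>+y. g l y \<partial>K l) \<le> 1" for l
  proof (cases "l \<in> Z")
    case True
    have "(\<integral>\<^sup>+y. g l y \<partial>K l) = ennreal (exp p) * emeasure (K l) {y. \<not> x < J l y}"
      using True by (simp add: g_def nn_integral_cmult_indicator)
    also have "\<dots> = ennreal (exp p * (1 - measure_pmf.prob (K l) {y. x < J l y}))"
    proof -
      have "{y. \<not> x < J l y} = space (K l) - {y. x < J l y}" by auto
      then have "measure_pmf.prob (K l) {y. \<not> x < J l y} = 1 - measure_pmf.prob (K l) {y. x < J l y}"
        using measure_pmf.prob_compl[of "{y. x < J l y}" "K l"] by (simp only: sets_measure_pmf UNIV_I)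
      then show ?thesis by (simp add: measure_pmf.emeasure_eq_measure ennreal_mult)
    qed
    also have "\<dots> \<le> ennreal (exp p * (1 - p))"
      using p[OF True] by (intro ennreal_leI mult_left_mono) auto
    also have "\<dots> \<le> ennreal (exp p * exp (- p))"
      using exp_ge_add_one_self[of "- p"] by (intro ennreal_leI mult_left_mono) auto
    also have "\<dots> = 1" by (simp add: exp_minus)
    finally show ?thesis .
  next
    case False
    then show ?thesis by (simp add: g_def)
  qed
  have Y_Suc: "Y (Suc t) (path \<omega>) = Y t (path \<omega>) * g (X t \<omega>) (X (Suc t) \<omega>)" for t \<omega>
    by (auto simp: Y_def g_def visits_Suc less_Suc_eq exp_add ennreal_mult distrib_left)
  have E: "(\<integral>\<^sup>+\<omega>. Y t (path \<omega>) \<partial>M) \<le> 1" for t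
  proof (induction t)
    case 0
    then show ?case by (simp add: Y_def emeasure_space_1)
  next
    case (Suc t)
    have "(\<integral>\<^sup>+\<omega>. Y (Suc t) (path \<omega>) \<partial>M) = (\<integral>\<^sup>+\<omega>. Y t (path \<omega>) * (\<integral>\<^sup>+y. g (X t \<omega>) y \<partial>K (X t \<omega>)) \<partial>M)"
      unfolding Y_Suc by (rule nn_integral_step[OF det])
    also have "\<dots> \<le> (\<integral>\<^sup>+\<omega>. Y t (path \<omega>) * 1 \<partial>M)"
      by (intro nn_integral_mono mult_left_mono g_le) auto
    finally show ?case using Suc by simp
  qed
  let ?E = "{\<omega> \<in> space M. n \<le> real (visits Z t (path \<omega>)) \<and>
      (\<forall>s<t. X s \<omega> \<in> Z \<longrightarrow> \<not> x < J (X s \<omega>) (X (Suc s) \<omega>))}"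
  have [measurable]: "Measurable.pred M (\<lambda>\<omega>. x < J (X s \<omega>) (X (Suc s) \<omega>))" for s
    by (rule transition_measurable)
  have E_sets: "?E \<in> sets M" by measurable
  have "ennreal (prob ?E) = (\<integral>\<^sup>+\<omega>. indicator ?E \<omega> \<partial>M)"
    using E_sets by (simp add: emeasure_eq_measure)
  also have "\<dots> \<le> (\<integral>\<^sup>+\<omega>. ennreal (exp (- (p * n))) * Y t (path \<omega>) \<partial>M)"
  proof (intro nn_integral_mono)
    fix \<omega>
    show "indicator ?E \<omega> \<le> ennreal (exp (- (p * n))) * Y t (path \<omega>)"
    proof (cases "\<omega> \<in> ?E")
      case True
      then have "p * n \<le> p * real (visits Z t (path \<omega>))"
        using p0 by (intro mult_left_mono) auto
      then show ?thesis
        using True by (auto simp: Y_def ennreal_mult[symmetric] exp_add[symmetric])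
    qed simp
  qed
  also have "\<dots> = ennreal (exp (- (p * n))) * (\<integral>\<^sup>+\<omega>. Y t (path \<omega>) \<partial>M)"
    by (intro nn_integral_cmult determined_borel_measurable[OF det])
  also have "\<dots> \<le> ennreal (exp (- (p * n))) * 1"
    by (intro mult_left_mono E) auto
  finally show ?thesis by simp
qed

text \<open>
  Borel-Cantelli over the deterministic times \<open>t\<close>.
\<close>
lemma AE_eventually_large_jump:
  assumes p: "\<And>t z. z \<in> Z \<Longrightarrow> p t \<le> measure_pmf.prob (K z) {y. x t < J z y}" and p0: "\<And>t. 0 \<le> p t"
    and summ: "summable (\<lambda>t. exp (- (p t * n t)))"
    and visits: "AE \<omega> in M. \<forall>\<^sub>F t in sequentially. n t \<le> real (visits Z t (path \<omega>))"
  shows "AE \<omega> in M. \<forall>\<^sub>F t in sequentially. \<exists>s<t. X s \<omega> \<in> Z \<and> x t < J (X s \<omega>) (X (Suc s) \<omega>)"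
proof -
  let ?E = "\<lambda>t. {\<omega> \<in> space M. n t \<le> real (visits Z t (path \<omega>)) \<and>
      (\<forall>s<t. X s \<omega> \<in> Z \<longrightarrow> \<not> x t < J (X s \<omega>) (X (Suc s) \<omega>))}"
  have bound: "prob (?E t) \<le> exp (- (p t * n t))" for t
    using p p0 by (rule prob_no_large_jump)
  have [measurable]: "Measurable.pred M (\<lambda>\<omega>. x t < J (X s \<omega>) (X (Suc s) \<omega>))" for s t
    by (rule transition_measurable)
  have sets: "?E t \<in> sets M" for t by measurable
  have "summable (\<lambda>t. prob (?E t))"
    using bound by (intro summable_comparison_test[OF _ summ]) auto
  then have "AE \<omega> in M. \<forall>\<^sub>F t in sequentially. \<omega> \<in> space M - ?E t"
    using sets by (intro borel_cantelli_AE1) (auto simp: emeasure_eq_measure)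
  with visits show ?thesis
  proof eventually_elim
    case (elim \<omega>)
    from elim show ?case by eventually_elim auto
  qed
qed

end

section \<open>Return times, irreducibility and chains on a strip\<close>

lemma first_return_gt_iff: "enat t < first_return x u \<longleftrightarrow> (\<forall>i\<in>{1..t}. u i \<noteq> x)"
proof
  assume lt: "enat t < first_return x u"
  show "\<forall>i\<in>{1..t}. u i \<noteq> x"
  proof (intro ballI notI)
    fix i assume "i \<in> {1..t}" "u i = x"
    then have "first_return x u \<le> enat i" unfolding first_return_def by (intro Inf_lower) auto
    also have "\<dots> \<le> enat t" using \<open>i \<in> {1..t}\<close> by simp
    finally show False using lt by simp
  qed
next
  assume no: "\<forall>i\<in>{1..t}. u i \<noteq> x"
  have "enat (Suc t) \<le> first_return x u"
    unfolding first_return_def using no by (intro Inf_greatest) (force simp: not_less_eq_eq[symmetric])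
  then show "enat t < first_return x u" by (metis Suc_ile_eq)
qed

lemma chain_law_countable_markov_chain:
  fixes K :: "'s::countable \<Rightarrow> 's pmf"
  shows "countable_markov_chain (chain_law K x) UNIV K (\<lambda>t u. u t)"
  unfolding countable_markov_chain_def countable_markov_chain_axioms_def
  by (intro conjI prob_space_chain_law markov_chain_chain_law(1))

lemma return_tail_eq_avoid:
  fixes K :: "'s::countable \<Rightarrow> 's pmf"
  shows "avoid K {x} t x = ennreal \<P>(u in chain_law K x. first_return x u > enat t)"
proof -
  interpret countable_markov_chain "chain_law K x" UNIV K "\<lambda>t u. u t"
    by (rule chain_law_countable_markov_chain)
  let ?E = "{u \<in> space (chain_law K x). first_return x u > enat t}"
  have E: "?E = {u \<in> space (chain_law K x). \<forall>i\<in>{1..t}. u i \<noteq> x}"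
    by (simp add: first_return_gt_iff)
  have E_sets: "?E \<in> sets (chain_law K x)"
    unfolding E using X_measurable by measurable
  have "ennreal (prob ?E) = (\<integral>\<^sup>+u. indicator ?E u \<partial>chain_law K x)"
    by (simp only: nn_integral_indicator[OF E_sets] emeasure_eq_measure)
  also have "\<dots> = (\<integral>\<^sup>+u. 1 * of_bool (\<forall>i\<in>{1..t}. u (0 + i) \<notin> {x}) \<partial>chain_law K x)"
    by (intro nn_integral_cong) (auto simp: first_return_gt_iff indicator_def)
  also have "\<dots> = (\<integral>\<^sup>+u. 1 * avoid K {x} t (u 0) \<partial>chain_law K x)"
    by (rule nn_integral_avoid[where a = "\<lambda>_. 1"]) (simp add: determined_by_def)
  also have "\<dots> = (\<integral>\<^sup>+u. avoid K {x} t x \<partial>chain_law K x)"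
    using markov_chain_chain_law(2)[of x K] by (intro nn_integral_cong_AE) auto
  also have "\<dots> = avoid K {x} t x" by (simp add: emeasure_space_1 del: space_chain_law)
  finally show ?thesis ..
qed

text \<open>
  The states from which \<open>x\<close> is almost surely reached include \<open>x\<close> and are closed under
  possible steps, so the chain started at \<open>x\<close> never leaves them; irreducibility puts \<open>y\<close>
  among them.
\<close>
lemma avoid_tendsto_0_irreducible:
  fixes K :: "'s::countable \<Rightarrow> 's pmf"
  assumes irr: "irreducible_chain A K" and x: "x \<in> A" and y: "y \<in> A"
    and lim: "(\<lambda>m. avoid K {x} m x) \<longlonglongrightarrow> 0"
  shows "(\<lambda>m. avoid K {x} m y) \<longlonglongrightarrow> 0"
proof -
  interpret countable_markov_chain "chain_law K x" UNIV K "\<lambda>t u. u t"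
    by (rule chain_law_countable_markov_chain)
  define G where "G = {l. (\<lambda>m. avoid K {x} m l) \<longlonglongrightarrow> 0}"
  have step: "l' \<in> G" if "l \<in> G" "l' \<in> set_pmf (K l)" for l l'
    using avoid_tendsto_0_step[of K "{x}" l l'] that lim by (cases "l' = x") (auto simp: G_def)
  have AE: "AE u in chain_law K x. u n \<in> G" for n
  proof (induction n)
    case 0
    then show ?case using markov_chain_chain_law(2)[of x K] lim by (auto simp: G_def)
  next
    case (Suc n)
    then show ?case using AE_step_in_set_pmf[of n] by eventually_elim (rule step)
  qed
  obtain n where n: "\<P>(u in chain_law K x. u n = y) > 0"
    using irr x y by (auto simp: irreducible_chain_def)
  have "y \<in> G"
  proof (rule ccontr)
    assume "y \<notin> G"
    from AE[of n] have "AE u in chain_law K x. u n \<noteq> y"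
      by eventually_elim (use \<open>y \<notin> G\<close> in auto)
    then have "\<P>(u in chain_law K x. u n = y) = 0"
      by (subst prob_Collect_eq_0) (use X_measurable[of n] in measurable)
    with n show False by simp
  qed
  then show ?thesis by (simp add: G_def)
qed

lemma nn_integral_strip_kernel_increment:
  "(\<integral>\<^sup>+y. f (snd y - x) \<partial>strip_kernel \<phi> (l, x)) = (\<integral>\<^sup>+d. f d \<partial>increment_law \<phi> l)"
  by (simp add: strip_kernel_def increment_law_def case_prod_beta)

lemma avoid_strip_kernel:
  "avoid (strip_kernel \<phi>) ({l0} \<times> UNIV) m (l, x) = avoid (induced_kernel \<phi>) {l0} m l"
proof (induction m arbitrary: l x)
  case (Suc m)
  then show ?case
    by (simp add: strip_kernel_def induced_kernel_def case_prod_beta) (simp add: indicator_def)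
qed simp

lemma pos_part_of_int: "pos_part (real_of_int d) = real (nat d)"
  by (simp add: pos_part_def indicator_def)

lemma pos_part_diff_neg_part: "pos_part r - neg_part r = r"
  and pos_part_nonneg: "0 \<le> pos_part r" and neg_part_nonneg: "0 \<le> neg_part r"
  by (auto simp: pos_part_def neg_part_def indicator_def)

section \<open>The growth exponent\<close>

theorem theorem3p2:
  fixes A :: "nat set" and \<phi> :: strip_transitions
    and M :: "'w measure" and U :: "nat \<Rightarrow> 'w \<Rightarrow> nat" and V :: "nat \<Rightarrow> 'w \<Rightarrow> int"
    and \<alpha> \<beta> \<gamma> :: real and C :: ennreal
  assumes A: "(\<exists>k\<ge>1. A = {0..<k}) \<or> A = UNIV"
    and transitions: "strip_transitions_on A \<phi>"
    and chain: "markov_chain M (A \<times> UNIV) (strip_kernel \<phi>) (\<lambda>t \<omega>. (U t \<omega>, V t \<omega>))"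
    and irreducible: "irreducible_chain A (induced_kernel \<phi>)"
    and null_recurrent: "null_recurrent_chain A (induced_kernel \<phi>)"
    and \<gamma>: "0 < \<gamma>" "\<gamma> \<le> 1"
    and return_tail:
      "(\<lambda>t. ln (\<P>(u in chain_law (induced_kernel \<phi>) 0. first_return 0 u > enat t)) / ln (real t))
         \<longlonglongrightarrow> - \<gamma>"
    and \<alpha>: "0 < \<alpha>" "\<alpha> < 1" and \<beta>: "0 < \<beta>" and C: "C < \<infinity>"
    and i: "\<And>l. l \<in> A \<Longrightarrow> M_minus \<phi> l \<beta> \<le> C"
    and ii: "((\<lambda>x. ln (T_plus \<phi> 0 x) / ln x) \<longlongrightarrow> - \<alpha>) at_top"
    and iii: "\<And>l. l \<in> A \<Longrightarrow> l \<noteq> 0 \<Longrightarrow> M_plus \<phi> l \<beta> \<le> C"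
    and less: "\<alpha> < \<gamma> * min \<beta> 1"
  shows "(AE \<omega> in M. filterlim (\<lambda>t. V t \<omega>) at_top sequentially) \<and>
         (AE \<omega> in M. (\<lambda>t. ln (real_of_int (V t \<omega>)) / ln (real t)) \<longlonglongrightarrow> \<gamma> / \<alpha>)"
proof -
  define K where "K = strip_kernel \<phi>"
  define X where "X t \<omega> = (U t \<omega>, V t \<omega>)" for t \<omega>
  define Z :: "(nat \<times> int) set" where "Z = {0} \<times> UNIV"
  define T where "T t = \<P>(u in chain_law (induced_kernel \<phi>) 0. first_return 0 u > enat t)" for t
  interpret countable_markov_chain M "A \<times> UNIV" K X
    using chain by (simp add: countable_markov_chain_def countable_markov_chain_axioms_def
        K_def X_def[abs_def] markov_chain_def)
  have Z_iff: "X t \<omega> \<in> Z \<longleftrightarrow> U t \<omega> = 0" for t \<omega> by (auto simp: X_def Z_def)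
  have zero_A: "0 \<in> A" using A by auto

  have T: "avoid K Z m z = ennreal (T m)" if "z \<in> Z" for z m
    using that avoid_strip_kernel[of \<phi> 0 m 0] return_tail_eq_avoid[of "induced_kernel \<phi>" 0 m]
    by (auto simp: Z_def K_def T_def)
  have T0: "0 \<le> T m" for m by (simp add: T_def)
  have T_bounds: "\<forall>\<^sub>F t in sequentially. real t powr - b \<le> T t \<and> T t \<le> real t powr - a"
    if "a < \<gamma>" "\<gamma> < b" for a b
    using return_tail filterlim_real_sequentially T0 \<gamma>(1) that
    unfolding T_def[symmetric] by (rule eventually_powr_bounds_of_log_ratio)
  have T_upper: "\<forall>\<^sub>F t in sequentially. T t \<le> real t powr - a" if "a < \<gamma>" for a
    using T_bounds[OF that, of "\<gamma> + 1"] by (auto elim: eventually_mono)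
  (* The decay of the tail makes a return to the 0-line certain; irreducibility carries this over to
     hitting the line from every starting state. *)
  have T_lim: "T \<longlonglongrightarrow> 0"
  proof (rule tendsto_sandwich[where f = "\<lambda>_. 0"])
    show "\<forall>\<^sub>F t in sequentially. T t \<le> real t powr - (\<gamma> / 2)" using \<gamma> by (intro T_upper) simp
    show "(\<lambda>t. real t powr - (\<gamma> / 2)) \<longlonglongrightarrow> 0" using \<gamma> by real_asymp
  qed (use T0 in auto)

  have hits: "AE \<omega> in M. \<exists>t. X t \<omega> \<in> Z"
  proof (rule AE_hits)
    fix l assume "l \<in> A \<times> (UNIV :: int set)"
    then obtain u x where l: "l = (u, x)" "u \<in> A" by auto
    have "(\<lambda>m. ennreal (T m)) \<longlonglongrightarrow> 0"
      using tendsto_ennrealI[OF T_lim] by simp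
    then have "(\<lambda>m. avoid (induced_kernel \<phi>) {0} m 0) \<longlonglongrightarrow> 0"
      by (simp add: return_tail_eq_avoid T_def)
    from avoid_tendsto_0_irreducible[OF irreducible zero_A l(2) this]
    show "(\<lambda>m. avoid K Z m l) \<longlonglongrightarrow> 0"
      by (simp add: l K_def Z_def avoid_strip_kernel)
  qed
  have visits_lower: "AE \<omega> in M. \<forall>\<^sub>F t in sequentially. real t powr \<rho> \<le> real (visits Z t (\<lambda>i. X i \<omega>))"
    if "0 < \<rho>" "\<rho> < \<gamma>" for \<rho>
    using T T0 T_upper hits that \<gamma>(2) by (rule AE_visits_ge_powr)

  have visit_probs: "summable (\<lambda>s. real (Suc s) powr - \<kappa> * prob {\<omega> \<in> space M. X s \<omega> \<in> Z})"
    if "\<gamma> < \<kappa>" for \<kappa>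
  proof (rule summable_powr_weights[where b = "(\<gamma> + \<kappa>) / 2"])
    have "\<forall>\<^sub>F t in sequentially. real t powr - ((\<gamma> + \<kappa>) / 2) \<le> T t"
      using T_bounds[of 0 "(\<gamma> + \<kappa>) / 2"] \<gamma> that by (auto elim: eventually_mono)
    then show "\<forall>\<^sub>F t in sequentially.
        (\<Sum>s\<le>t. prob {\<omega> \<in> space M. X s \<omega> \<in> Z}) \<le> real t powr ((\<gamma> + \<kappa>) / 2)"
      using eventually_gt_at_top[of 0]
    proof eventually_elim
      case (elim t)
      let ?G = "\<Sum>s\<le>t. prob {\<omega> \<in> space M. X s \<omega> \<in> Z}"
      have "?G * real t powr - ((\<gamma> + \<kappa>) / 2) \<le> ?G * T t"
        using elim by (intro mult_left_mono sum_nonneg) auto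
      also have "\<dots> \<le> 1" using T T0 by (rule expected_visits_times_tail_le_1)
      finally show ?case using elim by (simp add: powr_minus field_simps)
    qed
  qed (use \<gamma> that in auto)

  define \<beta>' where "\<beta>' = min \<beta> 1"
  have \<beta>': "0 < \<beta>'" "\<beta>' \<le> 1" "\<alpha> < \<gamma> * \<beta>'" using \<beta> less by (auto simp: \<beta>'_def)
  (* Increments split as J - W on the 0-line. Off the line W is the full absolute increment, so W
     collects everything of bounded \<beta>'-th moment and J matters only on the line. *)
  define D where "D x y = real_of_int (snd y - snd x)" for x y :: "nat \<times> int"
  define J where "J x y = pos_part (D x y)" for x y
  define W where "W x y = (if x \<in> Z then neg_part (D x y) else \<bar>D x y\<bar>)" for x y
  have J0: "0 \<le> J x y" and W0: "0 \<le> W x y" for x y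
    by (auto simp: J_def W_def pos_part_nonneg neg_part_nonneg)
  have D_eq: "D x y = J x y - W x y" if "x \<in> Z" for x y
    using that by (simp add: J_def W_def pos_part_diff_neg_part)
  have D_abs: "\<bar>D x y\<bar> = W x y" if "x \<notin> Z" for x y
    using that by (simp add: W_def)
  have W_moment: "(\<integral>\<^sup>+y. ennreal (W x y powr \<beta>') \<partial>K x) \<le> (2 + 2 * C) * indicator UNIV x"
    if x_in: "x \<in> A \<times> UNIV" for x
  proof -
    obtain l z where x: "x = (l, z)" "l \<in> A" using x_in by auto
    let ?I = "increment_law \<phi> l"
    have minus: "(\<integral>\<^sup>+d. ennreal (neg_part (real_of_int d) powr \<beta>') \<partial>?I) \<le> 1 + C"
      using nn_moment_min_1_le[of "\<lambda>d. neg_part (real_of_int d)" \<beta> ?I] \<beta> i[OF x(2)] neg_part_nonneg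
      unfolding \<beta>'_def M_minus_def by (meson add_left_mono order_trans)
    show ?thesis
    proof (cases "l = 0")
      case True
      have "(\<integral>\<^sup>+y. ennreal (W x y powr \<beta>') \<partial>K x) =
          (\<integral>\<^sup>+d. ennreal (neg_part (real_of_int d) powr \<beta>') \<partial>?I)"
        unfolding x K_def W_def D_def True
        using nn_integral_strip_kernel_increment[where f = "\<lambda>d. ennreal (neg_part (real_of_int d) powr \<beta>')"]
        by (simp add: Z_def)
      also have "\<dots> \<le> 1 + C" by (rule minus)
      also have "\<dots> \<le> 2 + 2 * C"
        by (intro add_mono) (auto simp: mult_2)
      finally show ?thesis by simp
    next
      case False
      have "(\<integral>\<^sup>+d. ennreal (pos_part (real_of_int d) powr \<beta>') \<partial>?I) \<le> 1 + C"
        using nn_moment_min_1_le[of "\<lambda>d. pos_part (real_of_int d)" \<beta> ?I] \<beta> iii[OF x(2) False] pos_part_nonneg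
        unfolding \<beta>'_def M_plus_def by (meson add_left_mono order_trans)
      note plus = this
      have "(\<integral>\<^sup>+y. ennreal (W x y powr \<beta>') \<partial>K x) =
          (\<integral>\<^sup>+d. ennreal (\<bar>real_of_int d\<bar> powr \<beta>') \<partial>?I)"
        unfolding x K_def W_def D_def
        using nn_integral_strip_kernel_increment[where f = "\<lambda>d. ennreal (\<bar>real_of_int d\<bar> powr \<beta>')"] False
        by (simp add: Z_def)
      also have "\<dots> = (\<integral>\<^sup>+d. ennreal (neg_part (real_of_int d) powr \<beta>') +
          ennreal (pos_part (real_of_int d) powr \<beta>') \<partial>?I)"
        by (intro nn_integral_cong) (auto simp: neg_part_def pos_part_def indicator_def)
      also have "\<dots> = (\<integral>\<^sup>+d. ennreal (neg_part (real_of_int d) powr \<beta>') \<partial>?I) +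
          (\<integral>\<^sup>+d. ennreal (pos_part (real_of_int d) powr \<beta>') \<partial>?I)"
        by (rule nn_integral_add) auto
      also have "\<dots> \<le> (1 + C) + (1 + C)" by (intro add_mono minus plus)
      also have "\<dots> = (1 + 1) + (C + C)" by (simp only: ac_simps)
      also have "\<dots> = 2 + 2 * C" by (simp only: one_add_one mult_2)
      finally show ?thesis by simp
    qed
  qed

  have small_sum: "AE \<omega> in M. \<exists>c. \<forall>t. (\<Sum>s<t. W (X s \<omega>) (X (Suc s) \<omega>)) \<le> c * real t powr q"
    if q: "1 / \<beta>' < q" for q
  proof -
    have q': "1 < q * \<beta>'" using q \<beta>' by (simp add: field_simps)
    have "AE \<omega> in M. (\<Sum>s. ennreal (real (Suc s) powr - (q * \<beta>')) *
        ennreal (W (X s \<omega>) (X (Suc s) \<omega>) powr \<beta>')) \<noteq> \<infinity>"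
    proof (rule AE_weighted_sum_finite[where Y = UNIV and c = "2 + 2 * C"])
      show "2 + 2 * C < \<infinity>" using C by (simp add: ennreal_mult_less_top)
      show "summable (\<lambda>s. real (Suc s) powr - (q * \<beta>') * prob {\<omega> \<in> space M. X s \<omega> \<in> UNIV})"
        using summable_Suc_powr[of "q * \<beta>' - 1"] q' by (simp add: prob_space)
    qed (use W_moment in auto)
    then show ?thesis
    proof eventually_elim
      case (elim \<omega>)
      have "(\<Sum>s. ennreal (real (Suc s) powr - (q * \<beta>') * W (X s \<omega>) (X (Suc s) \<omega>) powr \<beta>')) \<noteq> \<infinity>"
        using elim by (simp add: ennreal_mult)
      from sum_growth_of_weighted_series[OF W0 \<beta>'(1,2) _ this] q'
      obtain c where "\<And>t. (\<Sum>s<t. W (X s \<omega>) (X (Suc s) \<omega>)) \<le> c * real t powr (q * \<beta>' / \<beta>')"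
        by auto
      then show ?case using \<beta>' by auto
    qed
  qed

  have tail: "measure_pmf.prob (K z) {y. x < J z y} = T_plus \<phi> 0 x" if "z \<in> Z" for x z
    using that by (auto simp: Z_def K_def J_def D_def strip_kernel_def T_plus_def increment_law_def
        case_prod_beta intro!: arg_cong[where f = "measure _"])
  have tail_bounds: "\<forall>\<^sub>F x in at_top. x powr - b \<le> T_plus \<phi> 0 x \<and> T_plus \<phi> 0 x \<le> x powr - a"
    if "a < \<alpha>" "\<alpha> < b" for a b
    using ii filterlim_ident _ \<alpha>(1) that
    by (rule eventually_powr_bounds_of_log_ratio) (simp add: T_plus_def)

  have jump_sum: "AE \<omega> in M. \<exists>c. \<forall>t.
      (\<Sum>s<t. if X s \<omega> \<in> Z then J (X s \<omega>) (X (Suc s) \<omega>) else 0) \<le> c * real t powr q"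
    if q: "\<gamma> / \<alpha> < q" for q
  proof -
    have q0: "0 < q" using q \<alpha> \<gamma> by (meson divide_pos_pos less_trans)
    (* Any moment order a strictly between \<gamma> / q and \<alpha> works: the moment is finite as
       a < \<alpha>, and the weights with exponent q * a > \<gamma> are summable against the visit
       probabilities. *)
    define a where "a = (\<gamma> / q + \<alpha>) / 2"
    have "\<gamma> / q < \<alpha>" using q q0 \<alpha> by (simp add: field_simps)
    from less_half_sum[OF this] gt_half_sum[OF this] have a: "\<gamma> / q < a" "a < \<alpha>" by (simp_all only: a_def one_add_one)
    have a0: "0 < a" using a(1) \<gamma> q0 by (meson divide_pos_pos less_trans)
    have qa: "\<gamma> < q * a" using a q0 by (simp add: field_simps)
    define m where "m = (\<Sum>n. ennreal (real (Suc n) powr (a - 1) * T_plus \<phi> 0 (real n)))"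
    have m: "m < \<infinity>"
    proof -
      have ev: "\<forall>\<^sub>F x in at_top. T_plus \<phi> 0 x \<le> x powr - ((a + \<alpha>) / 2)"
        using tail_bounds[of "(a + \<alpha>) / 2" "\<alpha> + 1"] a by (auto elim: eventually_mono)
      have "summable (\<lambda>n. real (Suc n) powr (a - 1) * T_plus \<phi> 0 (real n))"
        using eventually_compose_filterlim[OF ev filterlim_real_sequentially] a
        by (intro summable_powr_times_tail[where b = "(a + \<alpha>) / 2"]) (auto simp: T_plus_def)
      then show ?thesis
        unfolding m_def by (subst suminf_ennreal2) (auto simp: T_plus_def)
    qed
    let ?g = "\<lambda>x y. ennreal ((if x \<in> Z then J x y else 0) powr a)"
    have "AE \<omega> in M. (\<Sum>s. ennreal (real (Suc s) powr - (q * a)) * ?g (X s \<omega>) (X (Suc s) \<omega>)) \<noteq> \<infinity>"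
    proof (rule AE_weighted_sum_finite[OF _ m])
      fix x
      show "(\<integral>\<^sup>+y. ?g x y \<partial>K x) \<le> m * indicator Z x"
      proof (cases "x \<in> Z")
        case True
        then have "(\<integral>\<^sup>+y. ?g x y \<partial>K x) = (\<integral>\<^sup>+y. ennreal (real (nat (snd y - snd x)) powr a) \<partial>K x)"
          by (simp add: J_def D_def pos_part_of_int del: of_int_diff)
        also have "\<dots> \<le> (\<Sum>n. ennreal (real (Suc n) powr (a - 1) *
            measure_pmf.prob (K x) {y. n < nat (snd y - snd x)}))"
          using a \<alpha> by (intro nn_moment_le_tail_series) simp
        also have "\<dots> = m"
        proof -
          have "{y. n < nat (snd y - snd x)} = {y. real n < J x y}" for n
            by (auto simp: J_def D_def pos_part_of_int simp del: of_int_diff)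
          then show ?thesis unfolding m_def using tail[OF True] by simp
        qed
        finally show ?thesis using True by simp
      qed simp
    qed (use visit_probs[OF qa] in auto)
    then show ?thesis
    proof eventually_elim
      case (elim \<omega>)
      let ?b = "\<lambda>s. if X s \<omega> \<in> Z then J (X s \<omega>) (X (Suc s) \<omega>) else 0"
      have fin: "(\<Sum>s. ennreal (real (Suc s) powr - (q * a) * ?b s powr a)) \<noteq> \<infinity>"
        using elim by (simp add: ennreal_mult)
      have b0: "0 \<le> ?b s" for s using J0 by simp
      have "a \<le> 1" "0 \<le> q * a" using a \<alpha> a0 q0 by auto
      then obtain c where "\<And>t. (\<Sum>s<t. ?b s) \<le> c * real t powr (q * a / a)"
        by (rule sum_growth_of_weighted_series[OF b0 a0 _ _ fin]) (rule that)
      then show ?case using a0 by auto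
    qed
  qed

  have large_jump: "AE \<omega> in M. \<forall>\<^sub>F t in sequentially. \<exists>s<t. X s \<omega> \<in> Z \<and>
      real t powr \<theta> < J (X s \<omega>) (X (Suc s) \<omega>)"
    if \<theta>: "0 < \<theta>" "\<theta> < \<gamma> / \<alpha>" for \<theta>
  proof -
    (* There are at least t powr \<rho> visits, and a jump exceeds t powr \<theta> with probability at
       least t powr (- \<theta> * b); the constants are chosen so that \<delta>, the exponent of the mean
       number of such jumps, is positive. *)
    define \<rho> where "\<rho> = (\<theta> * \<alpha> + \<gamma>) / 2"
    have "\<theta> * \<alpha> < \<gamma>" using \<theta> \<alpha> by (simp add: field_simps)
    from less_half_sum[OF this] gt_half_sum[OF this] have \<rho>: "\<theta> * \<alpha> < \<rho>" "\<rho> < \<gamma>" by (simp_all only: \<rho>_def one_add_one)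
    have \<rho>0: "0 < \<rho>" using \<rho>(1) \<theta> \<alpha> by (meson less_trans mult_pos_pos)
    define b where "b = (\<alpha> + \<rho> / \<theta>) / 2"
    have "\<alpha> < \<rho> / \<theta>" using \<rho> \<theta> by (simp add: field_simps)
    from less_half_sum[OF this] gt_half_sum[OF this] have b: "\<alpha> < b" "b < \<rho> / \<theta>" by (simp_all only: b_def one_add_one)
    define \<delta> where "\<delta> = \<rho> - \<theta> * b"
    have \<delta>: "0 < \<delta>" using b \<theta> by (simp add: \<delta>_def field_simps)
    show ?thesis
    proof (rule AE_eventually_large_jump[where p = "\<lambda>t. T_plus \<phi> 0 (real t powr \<theta>)" and n = "\<lambda>t. real t powr \<rho>"])
      have ev: "\<forall>\<^sub>F x in at_top. x powr - b \<le> T_plus \<phi> 0 x"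
        using tail_bounds[of 0 b] b \<alpha> by (auto elim: eventually_mono)
      have "filterlim (\<lambda>t. real t powr \<theta>) at_top sequentially" using \<theta> by real_asymp
      from eventually_compose_filterlim[OF ev this]
      have "\<forall>\<^sub>F t in sequentially.
          norm (exp (- (T_plus \<phi> 0 (real t powr \<theta>) * real t powr \<rho>))) \<le> exp (- (real t powr \<delta>))"
      proof eventually_elim
        case (elim t)
        have "real t powr \<delta> = (real t powr \<theta>) powr - b * real t powr \<rho>"
          by (simp add: \<delta>_def powr_powr powr_add[symmetric])
        also have "\<dots> \<le> T_plus \<phi> 0 (real t powr \<theta>) * real t powr \<rho>"
          using elim by (intro mult_right_mono) auto
        finally show ?case by simp
      qed
      then show "summable (\<lambda>t. exp (- (T_plus \<phi> 0 (real t powr \<theta>) * real t powr \<rho>)))"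
        by (rule summable_comparison_test_ev) (rule summable_exp_neg_powr[OF \<delta>])
    qed (use tail visits_lower[OF \<rho>0 \<rho>(2)] in \<open>auto simp: T_plus_def\<close>)
  qed

  define L where "L = \<gamma> / \<alpha>"
  define \<epsilon> where "\<epsilon> = L - 1 / \<beta>'"
  have \<epsilon>: "0 < \<epsilon>" "\<epsilon> < L"
    using \<beta>' \<alpha> by (simp_all add: \<epsilon>_def L_def field_simps)
  have V_eq: "real_of_int (V t \<omega>) = real_of_int (V 0 \<omega>) + (\<Sum>s<t. D (X s \<omega>) (X (Suc s) \<omega>))" for t \<omega>
    by (induction t) (auto simp: D_def X_def)
  have bounds: "AE \<omega> in M. \<forall>\<^sub>F t in sequentially.
      real t powr (L - e) \<le> real_of_int (V t \<omega>) \<and> real_of_int (V t \<omega>) \<le> real t powr (L + e)"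
    if e: "0 < e" "e \<le> \<epsilon>" for e
  proof -
    (* W is controlled at the exponent r for the lower bound, just below \<theta>, the exponent of
       the largest jump, and at q, slightly above L, for the upper bound. *)
    define r where "r = L - 3 * e / 4"
    define \<theta> where "\<theta> = L - e / 2"
    define q where "q = L + e / 2"
    have exps: "1 / \<beta>' < r" "1 / \<beta>' < q" "L < q" "0 < \<theta>" "\<theta> < L" "r < \<theta>" "q < L + e" "0 < q" "0 < r" "L - e < r"
    proof -
      have "L - e \<ge> 1 / \<beta>'" using e by (simp add: \<epsilon>_def)
      moreover have "0 < 1 / \<beta>'" using \<beta>' by simp
      ultimately show "1 / \<beta>' < r" "1 / \<beta>' < q" "L < q" "0 < \<theta>" "\<theta> < L" "r < \<theta>" "q < L + e" "0 < q" "0 < r" "L - e < r"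
        using e unfolding r_def \<theta>_def q_def by linarith+
    qed
    have "AE \<omega> in M. \<exists>c. \<forall>t. (\<Sum>s<t. if X s \<omega> \<in> Z then J (X s \<omega>) (X (Suc s) \<omega>) else 0) \<le> c * real t powr q"
      using exps by (intro jump_sum) (simp add: L_def)
    moreover have "AE \<omega> in M. \<forall>\<^sub>F t in sequentially. \<exists>s<t. X s \<omega> \<in> Z \<and>
        real t powr \<theta> < J (X s \<omega>) (X (Suc s) \<omega>)"
      using exps by (intro large_jump) (simp_all add: L_def)
    moreover note small_sum[OF exps(1)] small_sum[OF exps(2)]
    ultimately show ?thesis
    proof eventually_elim
      case (elim \<omega>)
      let ?J = "\<lambda>s. if X s \<omega> \<in> Z then J (X s \<omega>) (X (Suc s) \<omega>) else 0"
      let ?W = "\<lambda>s. W (X s \<omega>) (X (Suc s) \<omega>)"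
      let ?D = "\<lambda>s. D (X s \<omega>) (X (Suc s) \<omega>)"
      define v where "v = \<bar>real_of_int (V 0 \<omega>)\<bar>"
      have v: "real_of_int (V 0 \<omega>) \<le> v" "- v \<le> real_of_int (V 0 \<omega>)" by (auto simp: v_def)
      obtain c1 where c1: "\<And>t. (\<Sum>s<t. ?J s) \<le> c1 * real t powr q" using elim(1) by auto
      obtain c2 where c2: "\<And>t. (\<Sum>s<t. ?W s) \<le> c2 * real t powr r" using elim(3) by auto
      obtain c3 where c3: "\<And>t. (\<Sum>s<t. ?W s) \<le> c3 * real t powr q" using elim(4) by auto
      (* On the line D = J - W; off it the J-term is 0 and D lies between - W and W. *)
      have D_upper: "?D s \<le> ?J s + ?W s" and D_lower: "?J s \<le> ?D s + ?W s" for s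
        using D_eq[of "X s \<omega>" "X (Suc s) \<omega>"] D_abs[of "X s \<omega>" "X (Suc s) \<omega>"] W0[of "X s \<omega>" "X (Suc s) \<omega>"]
        by auto
      have J_nonneg: "0 \<le> ?J s" for s using J0 by simp
      have "\<forall>\<^sub>F t in sequentially. real t powr q * (\<bar>c1\<bar> + \<bar>c3\<bar> + 1) + v \<le> real t powr (L + e)"
        using exps by real_asymp
      moreover have "\<forall>\<^sub>F t in sequentially. real t powr r * (\<bar>c2\<bar> + 1) + v \<le> real t powr \<theta>"
        using exps by real_asymp
      ultimately show ?case using elim(2) eventually_gt_at_top[of 0]
      proof eventually_elim
        case (elim t)
        obtain s0 where s0: "s0 < t" "X s0 \<omega> \<in> Z" "real t powr \<theta> < ?J s0" using elim(3) by auto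
        have "real t powr \<theta> \<le> (\<Sum>s<t. ?J s)"
          using s0 J_nonneg member_le_sum[of s0 "{..<t}" ?J] by auto
        also have "\<dots> \<le> (\<Sum>s<t. ?D s) + (\<Sum>s<t. ?W s)"
          unfolding sum.distrib[symmetric] by (intro sum_mono D_lower)
        also have "\<dots> \<le> (\<Sum>s<t. ?D s) + \<bar>c2\<bar> * real t powr r"
          using c2[of t] mult_right_mono[OF abs_ge_self powr_ge_zero, of c2 "real t" r] by simp
        finally have "real t powr r \<le> real_of_int (V t \<omega>)"
          using elim(2) v unfolding V_eq[of t] by (simp add: algebra_simps)
        moreover have "real t powr (L - e) \<le> real t powr r"
          using exps elim(4) by (intro powr_mono) auto
        ultimately have lower: "real t powr (L - e) \<le> real_of_int (V t \<omega>)" by simp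
        have "(\<Sum>s<t. ?D s) \<le> (\<Sum>s<t. ?J s) + (\<Sum>s<t. ?W s)"
          unfolding sum.distrib[symmetric] by (intro sum_mono D_upper)
        also have "\<dots> \<le> \<bar>c1\<bar> * real t powr q + \<bar>c3\<bar> * real t powr q"
          using c1[of t] c3[of t] mult_right_mono[OF abs_ge_self powr_ge_zero, of c1 "real t" q]
            mult_right_mono[OF abs_ge_self powr_ge_zero, of c3 "real t" q] by simp
        also have "\<dots> \<le> real t powr q * (\<bar>c1\<bar> + \<bar>c3\<bar> + 1)"
          by (simp add: algebra_simps)
        finally have "real_of_int (V t \<omega>) \<le> real t powr (L + e)"
          using elim(1) v unfolding V_eq[of t] by linarith
        with lower show ?case by simp
      qed
    qed
  qed
  have "AE \<omega> in M. \<forall>n. \<forall>\<^sub>F t in sequentially. real t powr (L - \<epsilon> / real (Suc n)) \<le> real_of_int (V t \<omega>) \<and>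
      real_of_int (V t \<omega>) \<le> real t powr (L + \<epsilon> / real (Suc n))"
    unfolding AE_all_countable using \<epsilon> by (intro allI bounds) (auto simp: field_simps)
  then have "AE \<omega> in M. filterlim (\<lambda>t. real_of_int (V t \<omega>)) at_top sequentially \<and>
      (\<lambda>t. ln (real_of_int (V t \<omega>)) / ln (real t)) \<longlonglongrightarrow> L"
  proof eventually_elim
    case (elim \<omega>)
    then show ?case
      using log_limit_of_powr_bounds[OF \<epsilon>, of "\<lambda>t. real_of_int (V t \<omega>)"] by simp
  qed
  then have "AE \<omega> in M. filterlim (\<lambda>t. V t \<omega>) at_top sequentially \<and>
      (\<lambda>t. ln (real_of_int (V t \<omega>)) / ln (real t)) \<longlonglongrightarrow> L"
  proof eventually_elim
    case (elim \<omega>)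
    have "filterlim (\<lambda>t. V t \<omega>) at_top sequentially"
      unfolding filterlim_at_top
    proof
      fix z :: int
      from elim have "\<forall>\<^sub>F t in sequentially. real_of_int z \<le> real_of_int (V t \<omega>)"
        unfolding filterlim_at_top by blast
      then show "\<forall>\<^sub>F t in sequentially. z \<le> V t \<omega>" by (simp only: of_int_le_iff)
    qed
    with elim show ?case by simp
  qed
  then show ?thesis unfolding L_def by (simp only: AE_conj_iff)
qed

end
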